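(* Let $G$ be a finite simple undirected graph with nonempty vertex set. (a) The quantum chromatic number $\chi_q(G)$ is equal to the smallest integer $k\ge1$ for which there exists $X\in\mathcal{CS}_+^{|V(G)|k+1}$, with rows and columns indexed by $\{0\}\cup (V(G)\times[k])$, satisfying: $X[0,0]=1$; $\sum_{i,i'\in[k]}X[(g,i),(g,i')]=\sum_{i\in[k]}X[0,(g,i)]=1$ for all $g\in V(G)$; and $X[(g,i),(g',i')]=0$ whenever ($g=g'$ and $i\neq i'$) or ($g\sim g'$ and $i=i'$). (b) The quantum independence number $\alpha_q(G)$ is equal to the largest integer $k\ge1$ for which there exists $X\in\mathcal{CS}_+^{k|V(G)|+1}$, with rows and columns indexed by $\{0\}\cup([k]\times V(G))$, satisfying: $X[0,0]=1$; $\sum_{g,g'\in V(G)}X[(i,g),(i,g')]=\sum_{g\in V(G)}X[0,(i,g)]=1$ for all $i\in[k]$; and $X[(i,g),(i',g')]=0$ whenever ($i=i'$ and $g\ne g'$) or ($i\neq i'$ and $g\simeq g'$), where $g\simeq g'$ means $g=g'$ or $g\sim g'$.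
   Context: $\mathcal{CS}_+^n$: matrices $(\mathrm{Tr}(X_iX_j))_{i,j=1}^n$ with $X_i$ real symmetric psd $d\times d$ matrices (some $d\ge1$). $g\sim g'$ means adjacency in $G$; $\overline G$ is the complement graph; $K_k$ the complete graph on $k$ vertices; $[k]=\{1,\dots,k\}$. For finite simple graphs $H,G$, the $(H,G)$-homomorphism game is the nonlocal game with question sets $S=T=V(H)$, answer sets $A=B=V(G)$, distribution $\pi$ uniform on $\{(h,h):h\in V(H)\}\cup\{(h,h'):h\sim_H h'\}$, and predicate $V(g,g'|h,h')=0$ if ($h=h'$ and $g\neq g'$) or ($h\sim_H h'$ and ($g\not\sim_G g'$ or $g=g'$)), and $V(g,g'|h,h')=1$ otherwise. It admits a perfect quantum strategy if there are finite-dimensional complex Euclidean spaces $\mathcal X,\mathcal Y$, a unit vector $\psi\in\mathcal X\otimes\mathcal Y$, Hermitian psd operators $X_g^h$ on $\mathcal X$ with $\sum_{g} X_g^h=\mathbb I_{\mathcal X}$ for each $h\in V(H)$, and Hermitian psd operators $Y_g^h$ on $\mathcal Y$ with $\sum_{g} Y_g^h=\mathbb I_{\mathcal Y}$ for each $h$, such that $p(g,g'|h,h')=\psi^*(X_g^h\otimes Y_{g'}^{h'})\psi$ satisfies $\sum_{h,h'}\pi(h,h')\sum_{g,g'}V(g,g'|h,h')p(g,g'|h,h')=1$. $\chi_q(G)$ is the smallest $k\ge1$ for which the $(G,K_k)$-homomorphism game admits a perfect quantum strategy. $\alpha_q(G)$ is the largest $k\ge1$ for which the $(K_k,\overline G)$-homomorphism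 game admits a perfect quantum strategy. *)

theory Defs
  imports
    "Jordan_Normal_Form.Schur_Decomposition"
    "Graph_Theory.Pair_Digraph"
    "Graph_Theory.Kuratowski"
begin

section \<open>Matrices\<close>

text \<open>
  Over \<^typ>\<open>complex\<close>, \<^const>\<open>mat_adjoint\<close> is the conjugate transpose, and \<open>0 \<le> z\<close> says that \<open>z\<close> is
  real and nonnegative (HOL-Library.Complex_Order), so \<open>psd d\<close> describes the Hermitian positive
  semidefinite \<open>d \<times> d\<close> matrices. Over \<^typ>\<open>real\<close> conjugation is the identity, so \<open>psd d\<close> describes
  the symmetric positive semidefinite ones.
\<close>

definition psd :: "nat \<Rightarrow> 'a :: conjugatable_ordered_field mat \<Rightarrow> bool" where
  "psd d A \<longleftrightarrow> A \<in> carrier_mat d d \<and> mat_adjoint A = A \<and>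
     (\<forall>v \<in> carrier_vec d. 0 \<le> (A *\<^sub>v v) \<bullet>c v)"

lemma psd_real_iff:
  fixes A :: "real mat"
  shows "psd d A \<longleftrightarrow> A \<in> carrier_mat d d \<and> transpose_mat A = A \<and>
     (\<forall>v \<in> carrier_vec d. 0 \<le> v \<bullet> (A *\<^sub>v v))"
proof (cases "A \<in> carrier_mat d d")
  case True
  have adj: "mat_adjoint A = transpose_mat A"
    by (rule eq_matI) (auto simp: mat_adjoint_def mat_of_rows_def)
  have conj: "conjugate v = v" for v :: "real vec"
    by (rule eq_vecI) auto
  have "(A *\<^sub>v v) \<bullet> v = v \<bullet> (A *\<^sub>v v)" if "v \<in> carrier_vec d" for v
    using True that by (intro comm_scalar_prod[where n = d]) auto
  then show ?thesis
    unfolding psd_def adj conj by auto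
qed (auto simp: psd_def)

definition mat_trace :: "'a :: comm_monoid_add mat \<Rightarrow> 'a" where
  "mat_trace A = (\<Sum>i < dim_row A. A $$ (i, i))"

text \<open>
  The Kronecker product, under the identification of \<open>e\<^sub>i \<otimes> e\<^sub>j\<close> with the basis vector number
  \<open>i * n + j\<close> of a space of dimension \<open>m * n\<close>.
\<close>

definition kronecker :: "'a :: times mat \<Rightarrow> 'a mat \<Rightarrow> 'a mat" where
  "kronecker A B = mat (dim_row A * dim_row B) (dim_col A * dim_col B)
     (\<lambda>(i, j). A $$ (i div dim_row B, j div dim_col B) * B $$ (i mod dim_row B, j mod dim_col B))"

text \<open>
  The completely positive semidefinite cone, for matrices whose rows and columns are indexed by a
  finite set \<open>I\<close>; entries outside \<open>I \<times> I\<close> are irrelevant.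
\<close>

definition cs_plus :: "'i set \<Rightarrow> ('i \<Rightarrow> 'i \<Rightarrow> real) set" where
  "cs_plus I = {M. \<exists>d \<ge> 1. \<exists>X :: 'i \<Rightarrow> real mat.
     (\<forall>i \<in> I. psd d (X i)) \<and> (\<forall>i \<in> I. \<forall>j \<in> I. M i j = mat_trace (X i * X j))}"


section \<open>Nonlocal games and quantum strategies\<close>

record ('s, 't, 'a, 'b) nonlocal_game =
  questions1 :: "'s set"
  questions2 :: "'t set"
  answers1 :: "'a set"
  answers2 :: "'b set"
  distr :: "'s \<Rightarrow> 't \<Rightarrow> real"
  verdict :: "'a \<Rightarrow> 'b \<Rightarrow> 's \<Rightarrow> 't \<Rightarrow> real"

definition measurement :: "nat \<Rightarrow> 'a set \<Rightarrow> ('a \<Rightarrow> complex mat) \<Rightarrow> bool" where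
  "measurement d A X \<longleftrightarrow> (\<forall>a \<in> A. psd d (X a)) \<and>
     mat d d (\<lambda>ij. \<Sum>a \<in> A. X a $$ ij) = 1\<^sub>m d"

text \<open>\<open>Z \<mapsto> \<psi>\<^sup>* Z \<psi>\<close>; note that \<open>(\<bullet>c)\<close> conjugates its second argument.\<close>

definition expectation_value :: "complex vec \<Rightarrow> complex mat \<Rightarrow> complex" where
  "expectation_value \<psi> Z = (Z *\<^sub>v \<psi>) \<bullet>c \<psi>"

definition perfect_quantum_strategy :: "('s, 't, 'a, 'b) nonlocal_game \<Rightarrow> bool" where
  "perfect_quantum_strategy \<G> \<longleftrightarrow>
     (\<exists>m n \<psi> X Y.
        \<psi> \<in> carrier_vec (m * n) \<and> \<psi> \<bullet>c \<psi> = 1 \<and>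
        (\<forall>s \<in> questions1 \<G>. measurement m (answers1 \<G>) (X s)) \<and>
        (\<forall>t \<in> questions2 \<G>. measurement n (answers2 \<G>) (Y t)) \<and>
        (\<Sum>s \<in> questions1 \<G>. \<Sum>t \<in> questions2 \<G>. complex_of_real (distr \<G> s t) *
          (\<Sum>a \<in> answers1 \<G>. \<Sum>b \<in> answers2 \<G>. complex_of_real (verdict \<G> a b s t) *
            expectation_value \<psi> (kronecker (X s a) (Y t b)))) = 1)"


section \<open>Graphs\<close>

text \<open>
  A finite simple undirected graph is a \<^locale>\<open>pair_graph\<close>: a finite digraph without loops and
  parallel arcs whose set of arcs is symmetric. Vertices \<open>u\<close> and \<open>v\<close> are adjacent in \<open>G\<close> iff
  \<open>(u, v) \<in> parcs G\<close>.
\<close>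

definition complete_graph :: "nat \<Rightarrow> nat pair_pre_digraph" where
  "complete_graph k = \<lparr> pverts = {1..k}, parcs = {(i, j). i \<in> {1..k} \<and> j \<in> {1..k} \<and> i \<noteq> j} \<rparr>"

lemma complete_graph_complete_digraph: "complete_digraph k (with_proj (complete_graph k))"
  unfolding complete_digraph_pair_def by (auto simp: complete_graph_def)

definition complement_graph :: "'v pair_pre_digraph \<Rightarrow> 'v pair_pre_digraph" where
  "complement_graph G = \<lparr> pverts = pverts G,
     parcs = {(u, v). u \<in> pverts G \<and> v \<in> pverts G \<and> u \<noteq> v \<and> (u, v) \<notin> parcs G} \<rparr>"

lemma pair_graph_complement_graph:
  assumes "pair_graph G"
  shows "pair_graph (complement_graph G)"
proof -
  interpret pair_graph G by (fact assms)
  have "finite (pverts G \<times> pverts G)" by simp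
  then have "finite (parcs (complement_graph G))"
    by (rule rev_finite_subset) (auto simp: complement_graph_def)
  moreover have "sym (parcs G)"
    using pair_sym_arcs by (simp add: symmetric_def)
  ultimately show ?thesis
    by unfold_locales (auto simp: complement_graph_def symmetric_def intro!: symI dest: symD)
qed


section \<open>The homomorphism game, quantum chromatic and independence number\<close>

definition hom_game_questions :: "'h pair_pre_digraph \<Rightarrow> ('h \<times> 'h) set" where
  "hom_game_questions H = {(h, h) | h. h \<in> pverts H} \<union> {(h, h'). (h, h') \<in> parcs H}"

definition hom_game ::
  "'h pair_pre_digraph \<Rightarrow> 'g pair_pre_digraph \<Rightarrow> ('h, 'h, 'g, 'g) nonlocal_game" where
  "hom_game H G = \<lparr>
     questions1 = pverts H, questions2 = pverts H,
     answers1 = pverts G, answers2 = pverts G,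
     distr = (\<lambda>h h'. if (h, h') \<in> hom_game_questions H
                     then 1 / real (card (hom_game_questions H)) else 0),
     verdict = (\<lambda>g g' h h'.
       if (h = h' \<and> g \<noteq> g') \<or> ((h, h') \<in> parcs H \<and> ((g, g') \<notin> parcs G \<or> g = g'))
       then 0 else 1) \<rparr>"

definition chi_q :: "'v pair_pre_digraph \<Rightarrow> nat" where
  "chi_q G = (LEAST k. 1 \<le> k \<and> perfect_quantum_strategy (hom_game G (complete_graph k)))"

definition alpha_q :: "'v pair_pre_digraph \<Rightarrow> nat" where
  "alpha_q G =
     (GREATEST k. 1 \<le> k \<and> perfect_quantum_strategy (hom_game (complete_graph k) (complement_graph G)))"


section \<open>Feasibility over the completely positive semidefinite cone\<close>

text \<open>The index set \<open>{0} \<union> P\<close>, with \<^const>\<open>None\<close> for the additional index \<open>0\<close>.\<close>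

abbreviation with_zero :: "'p set \<Rightarrow> 'p option set" where
  "with_zero P \<equiv> insert None (Some ` P)"

definition cs_plus_coloring :: "'v pair_pre_digraph \<Rightarrow> nat \<Rightarrow> bool" where
  "cs_plus_coloring G k \<longleftrightarrow> (\<exists>X \<in> cs_plus (with_zero (pverts G \<times> {1..k})).
     X None None = 1 \<and>
     (\<forall>g \<in> pverts G.
        (\<Sum>i \<in> {1..k}. \<Sum>i' \<in> {1..k}. X (Some (g, i)) (Some (g, i'))) = 1 \<and>
        (\<Sum>i \<in> {1..k}. X None (Some (g, i))) = 1) \<and>
     (\<forall>g \<in> pverts G. \<forall>g' \<in> pverts G. \<forall>i \<in> {1..k}. \<forall>i' \<in> {1..k}.
        (g = g' \<and> i \<noteq> i') \<or> ((g, g') \<in> parcs G \<and> i = i') \<longrightarrow>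
        X (Some (g, i)) (Some (g', i')) = 0))"

definition cs_plus_independent :: "'v pair_pre_digraph \<Rightarrow> nat \<Rightarrow> bool" where
  "cs_plus_independent G k \<longleftrightarrow> (\<exists>X \<in> cs_plus (with_zero ({1..k} \<times> pverts G)).
     X None None = 1 \<and>
     (\<forall>i \<in> {1..k}.
        (\<Sum>g \<in> pverts G. \<Sum>g' \<in> pverts G. X (Some (i, g)) (Some (i, g'))) = 1 \<and>
        (\<Sum>g \<in> pverts G. X None (Some (i, g))) = 1) \<and>
     (\<forall>i \<in> {1..k}. \<forall>i' \<in> {1..k}. \<forall>g \<in> pverts G. \<forall>g' \<in> pverts G.
        (i = i' \<and> g \<noteq> g') \<or> (i \<noteq> i' \<and> (g = g' \<or> (g, g') \<in> parcs G)) \<longrightarrow>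
        X (Some (i, g)) (Some (i', g')) = 0))"

end

theory Submission
  imports Defs
begin

text \<open>
  Both parts are instances of one equivalence for the \<open>(H, G)\<close>-homomorphism game. Given a perfect
  strategy, write \<open>\<psi>\<close> as an \<open>m \<times> n\<close> matrix \<open>K\<close> and put \<open>N h g = K (Y h g)\<^sup>T K\<^sup>*\<close>; then the
  answer probabilities are the traces of \<open>X h g * N h' g'\<close>. Losing pairs have trace \<open>0\<close>, hence
  product \<open>0\<close>, and consistency gives \<open>X h g * K K\<^sup>* = N h g\<close>, so the positive semidefinite matrices
  \<open>N h g\<close>, which sum to \<open>K K\<^sup>*\<close> for each \<open>h\<close>, are mutually orthogonal on losing pairs. After
  normalisation and passage from complex to real matrices they form a feasible Gram matrix.

  Conversely, the normalisation conditions of a feasible Gram matrix say that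
  \<open>\<parallel>A - (\<Sum>g. M h g)\<parallel>\<^sup>2 = 0\<close>. Factor \<open>A = R R\<^sup>*\<close> with a left inverse \<open>S\<close> of \<open>R\<close>. The measurement
  operators \<open>S (M h g) S\<^sup>*\<close> and their transposes, with the state whose matrix is \<open>R\<^sup>* R\<close>, have
  answer probabilities equal to the traces of \<open>M h g * M h' g'\<close>.
\<close>

section \<open>Matrices\<close>

lemma mat_adjoint_carrier [simp]:
  "A \<in> carrier_mat m n \<Longrightarrow> mat_adjoint A \<in> carrier_mat n m"
  by (auto simp: mat_adjoint_def mat_of_rows_def)

lemma mat_adjoint_dim [simp]:
  "dim_row (mat_adjoint A) = dim_col A" "dim_col (mat_adjoint A) = dim_row A"
  by (auto simp: mat_adjoint_def mat_of_rows_def)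

lemma mat_adjoint_index:
  "A \<in> carrier_mat m n \<Longrightarrow> i < n \<Longrightarrow> j < m \<Longrightarrow> mat_adjoint A $$ (i, j) = conjugate (A $$ (j, i))"
  by (auto simp: mat_adjoint_def mat_of_rows_def)

lemma mat_mult_index:
  "A \<in> carrier_mat m n \<Longrightarrow> B \<in> carrier_mat n p \<Longrightarrow> i < m \<Longrightarrow> j < p \<Longrightarrow>
    (A * B) $$ (i, j) = (\<Sum>k<n. A $$ (i, k) * B $$ (k, j))"
  by (auto simp: scalar_prod_def lessThan_atLeast0 intro!: sum.cong)

lemma mat_mult_vec_index:
  "A \<in> carrier_mat m n \<Longrightarrow> v \<in> carrier_vec n \<Longrightarrow> i < m \<Longrightarrow>
    (A *\<^sub>v v) $ i = (\<Sum>k<n. A $$ (i, k) * v $ k)"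
  by (auto simp: scalar_prod_def lessThan_atLeast0 intro!: sum.cong)

lemma cscalar_prod_sum:
  "w \<in> carrier_vec n \<Longrightarrow> v \<bullet>c w = (\<Sum>i<n. v $ i * conjugate (w $ i))"
  by (auto simp: scalar_prod_def lessThan_atLeast0 intro!: sum.cong)

lemma mat_adjoint_adjoint [simp]: "mat_adjoint (mat_adjoint A) = (A :: 'a :: conjugatable_field mat)"
  by (rule eq_matI) (auto simp: mat_adjoint_index[OF carrier_matI[OF refl refl]] mat_adjoint_index[OF mat_adjoint_carrier[OF carrier_matI[OF refl refl]]])

lemma mat_adjoint_mult:
  fixes A B :: "'a :: conjugatable_field mat"
  assumes A: "A \<in> carrier_mat m n" and B: "B \<in> carrier_mat n p"
  shows "mat_adjoint (A * B) = mat_adjoint B * mat_adjoint A"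
proof (rule eq_matI)
  fix i j assume "i < dim_row (mat_adjoint B * mat_adjoint A)" "j < dim_col (mat_adjoint B * mat_adjoint A)"
  then have ij: "i < p" "j < m" using A B by auto
  show "mat_adjoint (A * B) $$ (i, j) = (mat_adjoint B * mat_adjoint A) $$ (i, j)"
    using ij A B
    by (simp add: mat_adjoint_index[of _ m p] mat_mult_index[of _ m n _ p]
        mat_mult_index[of _ p n _ m] mat_adjoint_index[of _ m n] mat_adjoint_index[of _ n p]
        sum_conjugate conjugate_dist_mul mult.commute del: index_mult_mat)
qed (use A B in auto)

text \<open>Coordinate form, in which test vectors are arbitrary functions on \<open>nat\<close>
  because only their values below \<open>d\<close> enter. The factorisation works with these double
  sums.\<close>

lemma psd_index:
  assumes A: "(A :: 'a :: conjugatable_ordered_field mat) \<in> carrier_mat d d"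
  shows "psd d A \<longleftrightarrow> (\<forall>i<d. \<forall>j<d. conjugate (A $$ (j, i)) = A $$ (i, j)) \<and>
    (\<forall>v. 0 \<le> (\<Sum>i<d. \<Sum>j<d. A $$ (i, j) * v j * conjugate (v i)))"
proof -
  have 1: "mat_adjoint A = A \<longleftrightarrow> (\<forall>i<d. \<forall>j<d. conjugate (A $$ (j, i)) = A $$ (i, j))"
  proof -
    have "mat_adjoint A = A \<longleftrightarrow> (\<forall>i<d. \<forall>j<d. mat_adjoint A $$ (i, j) = A $$ (i, j))"
      using A by (simp only: mat_eq_iff mat_adjoint_dim carrier_matD) blast
    then show ?thesis using mat_adjoint_index[OF A] by metis
  qed
  have 2: "(A *\<^sub>v v) \<bullet>c v = (\<Sum>i<d. \<Sum>j<d. A $$ (i, j) * v $ j * conjugate (v $ i))"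
    if "v \<in> carrier_vec d" for v
    using A that by (simp add: cscalar_prod_sum[OF that] mat_mult_vec_index[OF A] sum_distrib_right
        del: index_mult_mat_vec)
  have 3: "(\<Sum>i<d. \<Sum>j<d. A $$ (i, j) * v j * conjugate (v i)) = (A *\<^sub>v vec d v) \<bullet>c vec d v" for v
    by (subst 2) auto
  have "(\<forall>v \<in> carrier_vec d. 0 \<le> (A *\<^sub>v v) \<bullet>c v) \<longleftrightarrow>
      (\<forall>v. 0 \<le> (\<Sum>i<d. \<Sum>j<d. A $$ (i, j) * v j * conjugate (v i)))"
    unfolding 3 by (metis 2 3 vec_carrier)
  then show ?thesis
    unfolding psd_def 1 using A by simp
qed

lemma psd_carrier: "psd d A \<Longrightarrow> A \<in> carrier_mat d d"
  by (simp add: psd_def)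

lemma psd_conjugate_index:
  "psd d A \<Longrightarrow> i < d \<Longrightarrow> j < d \<Longrightarrow> conjugate (A $$ (j, i)) = A $$ (i, j)"
  using psd_index[OF psd_carrier] by blast

lemma psd_quadratic_form:
  "psd d A \<Longrightarrow> 0 \<le> (\<Sum>i<d. \<Sum>j<d. A $$ (i, j) * v j * conjugate (v i))"
  using psd_index[OF psd_carrier] by blast

lemma psd_adjoint: "psd d A \<Longrightarrow> mat_adjoint A = A"
  by (simp add: psd_def)

lemma cscalar_prod_mult_mat_vec:
  fixes B :: "'a :: conjugatable_field mat"
  assumes B: "B \<in> carrier_mat m n" and v: "v \<in> carrier_vec m" and w: "w \<in> carrier_vec n"
  shows "(B *\<^sub>v w) \<bullet>c v = w \<bullet>c (mat_adjoint B *\<^sub>v v)"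
proof -
  have "(B *\<^sub>v w) \<bullet>c v = (\<Sum>i<m. \<Sum>j<n. B $$ (i, j) * w $ j * conjugate (v $ i))"
    using B v w by (simp add: cscalar_prod_sum[OF v] mat_mult_vec_index[OF B] sum_distrib_right
        del: index_mult_mat_vec)
  also have "\<dots> = (\<Sum>j<n. \<Sum>i<m. B $$ (i, j) * w $ j * conjugate (v $ i))"
    by (rule sum.swap)
  also have "\<dots> = w \<bullet>c (mat_adjoint B *\<^sub>v v)"
    using B v w mult_mat_vec_carrier[OF mat_adjoint_carrier[OF B] v]
    by (simp add: cscalar_prod_sum[of _ n] mat_mult_vec_index[of _ n m] mat_adjoint_index[OF B]
        sum_conjugate conjugate_dist_mul sum_distrib_left mult_ac del: index_mult_mat_vec)
  finally show ?thesis .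
qed

text \<open>Moving \<open>B\<close> across the inner product turns the quadratic form at
  \<open>v\<close> into that of \<open>A\<close> at
  \<open>mat_adjoint B *\<^sub>v v\<close>.\<close>

lemma psd_congruence:
  assumes A: "psd d A" and B: "B \<in> carrier_mat e d"
  shows "psd e (B * A * mat_adjoint B)"
proof -
  note A' = psd_carrier[OF A] and C = mat_adjoint_carrier[OF B]
  have "0 \<le> (B * A * mat_adjoint B *\<^sub>v v) \<bullet>c v" if v: "v \<in> carrier_vec e" for v
  proof -
    have "(B * A * mat_adjoint B *\<^sub>v v) = B *\<^sub>v (A *\<^sub>v (mat_adjoint B *\<^sub>v v))"
      using A' B C v by (simp add: assoc_mult_mat_vec[of _ e d _ e]
          assoc_mult_mat_vec[of _ e d _ d] mult_mat_vec_carrier[of _ d e])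
    then have "(B * A * mat_adjoint B *\<^sub>v v) \<bullet>c v = (A *\<^sub>v (mat_adjoint B *\<^sub>v v)) \<bullet>c (mat_adjoint B *\<^sub>v v)"
      using A' C v by (simp only: cscalar_prod_mult_mat_vec[OF B v] mult_mat_vec_carrier)
    then show ?thesis
      using A C v by (simp only: psd_def mult_mat_vec_carrier)
  qed
  moreover have "mat_adjoint (B * A * mat_adjoint B) = B * A * mat_adjoint B"
    unfolding mat_adjoint_mult[OF mult_carrier_mat[OF B A'] C] mat_adjoint_mult[OF B A']
      psd_adjoint[OF A] mat_adjoint_adjoint by (rule assoc_mult_mat[OF B A' C, symmetric])
  ultimately show ?thesis
    unfolding psd_def using mult_carrier_mat[OF mult_carrier_mat[OF B A'] C] by blast
qed

text \<open>The quadratic form of the transpose at \<open>v\<close> is that of \<open>A\<close> at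
  the conjugate of \<open>v\<close>.\<close>

lemma psd_transpose:
  fixes A :: "complex mat"
  assumes A: "psd d A"
  shows "psd d (transpose_mat A)"
proof -
  note A' = psd_carrier[OF A]
  have h: "i < d \<Longrightarrow> j < d \<Longrightarrow> cnj (A $$ (j, i)) = A $$ (i, j)"
    and q: "0 \<le> (\<Sum>i<d. \<Sum>j<d. A $$ (i, j) * v j * cnj (v i))" for i j v
    using psd_conjugate_index[OF A] psd_quadratic_form[OF A] by simp_all
  have "(\<Sum>i<d. \<Sum>j<d. A $$ (j, i) * v j * cnj (v i)) =
      (\<Sum>i<d. \<Sum>j<d. A $$ (i, j) * cnj (v j) * cnj (cnj (v i)))" for v
    by (subst sum.swap) (simp add: mult_ac)
  then have "0 \<le> (\<Sum>i<d. \<Sum>j<d. A $$ (j, i) * v j * cnj (v i))" for v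
    using q[of "\<lambda>i. cnj (v i)"] by simp
  then show ?thesis
    using A' h by (subst psd_index[of _ d]) auto
qed

lemma psd_one: "psd d (1\<^sub>m d :: complex mat)"
proof -
  have "mat_adjoint (1\<^sub>m d :: complex mat) = 1\<^sub>m d"
    by (rule eq_matI) (auto simp: mat_adjoint_index[OF one_carrier_mat])
  then show ?thesis
    by (auto simp: psd_def intro: conjugate_square_ge_0_vec)
qed

section \<open>Traces and entrywise sums of matrices\<close>

lemma trace_mult:
  assumes A: "A \<in> carrier_mat m n" and B: "B \<in> carrier_mat n m"
  shows "mat_trace (A * B) = (\<Sum>i<m. \<Sum>j<n. A $$ (i, j) * B $$ (j, i))"
  using A B by (auto simp: mat_trace_def mat_mult_index[OF A B] simp del: index_mult_mat(1))

lemma trace_mult_commute: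
  fixes A B :: "'a :: comm_semiring_0 mat"
  assumes A: "A \<in> carrier_mat m n" and B: "B \<in> carrier_mat n m"
  shows "mat_trace (A * B) = mat_trace (B * A)"
  unfolding trace_mult[OF A B] trace_mult[OF B A]
  by (subst sum.swap) (simp add: mult.commute)

text \<open>The dimension is a parameter because the empty sum must be a zero matrix of known size.
  The body agrees with the completeness condition in \<open>measurement\<close>.\<close>

definition mat_sum :: "nat \<Rightarrow> 'i set \<Rightarrow> ('i \<Rightarrow> 'a :: comm_monoid_add mat) \<Rightarrow> 'a mat" where
  "mat_sum d I X = mat d d (\<lambda>ij. \<Sum>i \<in> I. X i $$ ij)"

lemma mat_sum_carrier [simp]: "mat_sum d I X \<in> carrier_mat d d"
  by (simp add: mat_sum_def)

lemma mat_sum_index: "i < d \<Longrightarrow> j < d \<Longrightarrow> mat_sum d I X $$ (i, j) = (\<Sum>a \<in> I. X a $$ (i, j))"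
  by (simp add: mat_sum_def)

lemma mat_sum_cong: "(\<And>a. a \<in> I \<Longrightarrow> X a = Y a) \<Longrightarrow> mat_sum d I X = mat_sum d I Y"
  by (simp add: mat_sum_def)

lemma mat_sum_mult_right:
  fixes B :: "'a :: semiring_0 mat"
  assumes X: "\<And>a. a \<in> I \<Longrightarrow> X a \<in> carrier_mat d d" and B: "B \<in> carrier_mat d d"
  shows "mat_sum d I X * B = mat_sum d I (\<lambda>a. X a * B)"
proof (rule eq_matI)
  fix i j assume "i < dim_row (mat_sum d I (\<lambda>a. X a * B))" "j < dim_col (mat_sum d I (\<lambda>a. X a * B))"
  then have ij: "i < d" "j < d" by (auto simp: mat_sum_def)
  have "(\<Sum>k<d. (\<Sum>a\<in>I. X a $$ (i, k)) * B $$ (k, j)) = (\<Sum>a\<in>I. \<Sum>k<d. X a $$ (i, k) * B $$ (k, j))"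
    by (subst sum.swap) (simp add: sum_distrib_right)
  then show "(mat_sum d I X * B) $$ (i, j) = mat_sum d I (\<lambda>a. X a * B) $$ (i, j)"
    using ij by (simp add: mat_mult_index[OF mat_sum_carrier B] mat_sum_index
        mat_mult_index[OF X B] del: index_mult_mat)
qed (use B in \<open>auto simp: mat_sum_def\<close>)

lemma mat_sum_congruence:
  fixes B C :: "'a :: comm_ring_1 mat"
  assumes X: "\<And>a. a \<in> I \<Longrightarrow> X a \<in> carrier_mat d d"
    and B: "B \<in> carrier_mat e d" and C: "C \<in> carrier_mat d e"
  shows "mat_sum e I (\<lambda>a. B * X a * C) = B * mat_sum d I X * C"
proof (rule eq_matI)
  fix i j assume "i < dim_row (B * mat_sum d I X * C)" "j < dim_col (B * mat_sum d I X * C)"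
  then have ij: "i < e" "j < e" using B C by auto
  have c: "B * Z * C \<in> carrier_mat e e" "B * Z \<in> carrier_mat e d" if "Z \<in> carrier_mat d d" for Z
    using that B C by auto
  have *: "(B * Z * C) $$ (i, j) = (\<Sum>l<d. \<Sum>k<d. B $$ (i, k) * Z $$ (k, l) * C $$ (l, j))"
    if Z: "Z \<in> carrier_mat d d" for Z
    using ij by (simp add: mat_mult_index[OF c(2)[OF Z] C] mat_mult_index[OF B Z] sum_distrib_right
        del: index_mult_mat)
  have "mat_sum e I (\<lambda>a. B * X a * C) $$ (i, j) =
      (\<Sum>a\<in>I. \<Sum>l<d. \<Sum>k<d. B $$ (i, k) * X a $$ (k, l) * C $$ (l, j))"
    using ij X by (simp add: mat_sum_index * del: index_mult_mat)
  also have "\<dots> = (\<Sum>l<d. \<Sum>k<d. \<Sum>a\<in>I. B $$ (i, k) * X a $$ (k, l) * C $$ (l, j))"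
    by (subst sum.swap, rule sum.cong[OF refl], rule sum.swap)
  also have "\<dots> = (B * mat_sum d I X * C) $$ (i, j)"
    by (subst *) (auto simp: mat_sum_index sum_distrib_left sum_distrib_right)
  finally show "mat_sum e I (\<lambda>a. B * X a * C) $$ (i, j) = (B * mat_sum d I X * C) $$ (i, j)" .
qed (use B C in \<open>auto simp: mat_sum_def\<close>)

lemma trace_mat_sum:
  "(\<And>a. a \<in> I \<Longrightarrow> X a \<in> carrier_mat d d) \<Longrightarrow> mat_trace (mat_sum d I X) = (\<Sum>a \<in> I. mat_trace (X a))"
  by (simp add: mat_trace_def mat_sum_def) (subst sum.swap, auto intro!: sum.cong)

section \<open>Positive semidefinite matrices\<close>

text \<open>Schur complement at the pivot \<open>A l l\<close>: its quadratic form at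
  \<open>v\<close> equals that of \<open>A\<close> at a vector \<open>w\<close> that differs from
  \<open>v\<close> only in coordinate \<open>l\<close>.\<close>

lemma psd_pivot:
  fixes A :: "nat \<Rightarrow> nat \<Rightarrow> complex"
  assumes pos: "\<And>v. 0 \<le> (\<Sum>i<d. \<Sum>j<d. A i j * v j * cnj (v i))"
    and l: "l < d" and nz: "A l l \<noteq> 0"
  shows "0 \<le> (\<Sum>i<d. \<Sum>j<d. (A i j - A i l * A l j / A l l) * v j * cnj (v i))"
proof -
  \<comment> \<open>This shift makes coordinate \<open>l\<close> of the image of \<open>w\<close>
    under \<open>A\<close> vanish.\<close>
  define t where "t = (\<Sum>j<d. A l j * v j) / A l l"
  define w where "w = v(l := v l - t)"
  have w: "w j = v j - (if j = l then t else 0)" for j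
    by (simp add: w_def)
  have row: "(\<Sum>j<d. A i j * w j) = (\<Sum>j<d. (A i j - A i l * A l j / A l l) * v j)" for i
  proof -
    have "(\<Sum>j<d. A i j * w j) = (\<Sum>j<d. A i j * v j - (if j = l then A i l * t else 0))"
      by (auto simp: w algebra_simps intro!: sum.cong)
    also have "\<dots> = (\<Sum>j<d. A i j * v j) - A i l * t"
      using l by (simp add: sum_subtractf)
    also have "A i l * t = (\<Sum>j<d. A i l * A l j / A l l * v j)"
      by (simp add: t_def sum_distrib_left sum_divide_distrib mult_ac)
    finally show ?thesis
      by (simp add: sum_subtractf algebra_simps)
  qed
  have zero: "(\<Sum>j<d. (A l j - A l l * A l j / A l l) * v j) = 0"
    using nz by simp
  have "(\<Sum>i<d. \<Sum>j<d. A i j * w j * cnj (w i)) =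
      (\<Sum>i<d. (\<Sum>j<d. (A i j - A i l * A l j / A l l) * v j) * cnj (w i))"
    by (simp add: row[symmetric] sum_distrib_right)
  \<comment> \<open>Replacing \<open>w i\<close> by \<open>v i\<close> affects only the term
    \<open>i = l\<close>, whose row sum is 0 by \<open>zero\<close>.\<close>
  also have "\<dots> = (\<Sum>i<d. (\<Sum>j<d. (A i j - A i l * A l j / A l l) * v j) * cnj (v i))"
    by (rule sum.cong[OF refl]) (use zero in \<open>auto simp: w\<close>)
  finally show ?thesis
    using pos[of w] by (simp add: sum_distrib_right)
qed

lemma psd_diag_nonneg:
  fixes A :: "nat \<Rightarrow> nat \<Rightarrow> complex"
  assumes pos: "\<And>v. 0 \<le> (\<Sum>i<d. \<Sum>j<d. A i j * v j * cnj (v i))" and l: "l < d"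
  shows "0 \<le> A l l"
proof -
  have "(\<Sum>i<d. \<Sum>j<d. A i j * (if j = l then 1 else 0) * cnj (if i = l then 1 else 0)) =
      (\<Sum>i<d. if i = l then A l l else 0)"
    using l by (intro sum.cong refl) (auto simp: if_distrib[of "\<lambda>x. _ * x"] cong: if_cong)
  then show ?thesis
    using pos[of "\<lambda>j. if j = l then 1 else 0"] l by simp
qed

lemma psd_zero_diag:
  fixes A :: "nat \<Rightarrow> nat \<Rightarrow> complex"
  assumes herm: "\<And>i j. i < d \<Longrightarrow> j < d \<Longrightarrow> cnj (A j i) = A i j"
    and pos: "\<And>v. 0 \<le> (\<Sum>i<d. \<Sum>j<d. A i j * v j * cnj (v i))"
    and diag: "\<And>i. i < d \<Longrightarrow> A i i = 0" and l: "l < d" "m < d"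
  shows "A l m = 0"
proof (cases "l = m")
  case False
  \<comment> \<open>With both diagonal entries zero, this test vector turns the quadratic form into
    minus twice the squared modulus of \<open>A l m\<close>.\<close>
  define v where "v j = (if j = l then - A l m else if j = m then 1 else 0)" for j
  have *: "(\<Sum>j<d. f j * v j) = - A l m * f l + f m" for f
  proof -
    have "(\<Sum>j<d. f j * v j) = (\<Sum>j<d. (if j = l then - A l m * f l else 0) + (if j = m then f m else 0))"
      using False by (intro sum.cong refl) (auto simp: v_def)
    then show ?thesis using l by (simp add: sum.distrib)
  qed
  have **: "(\<Sum>j<d. f j * cnj (v j)) = - cnj (A l m) * f l + f m" for f
  proof -
    have "(\<Sum>j<d. f j * cnj (v j)) = (\<Sum>j<d. (if j = l then - cnj (A l m) * f l else 0) + (if j = m then f m else 0))"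
      using False by (intro sum.cong refl) (auto simp: v_def)
    then show ?thesis using l by (simp add: sum.distrib)
  qed
  have "(\<Sum>i<d. \<Sum>j<d. A i j * v j * cnj (v i)) = - 2 * (A l m * cnj (A l m))"
    unfolding sum_distrib_right[symmetric] * ** using diag[OF l(1)] diag[OF l(2)] herm[OF l(2,1)]
    by (simp add: algebra_simps)
  then have "0 \<le> - 2 * (A l m * cnj (A l m))"
    using pos[of v] by simp
  then have "(cmod (A l m))\<^sup>2 \<le> 0"
    by (auto simp: complex_norm_square[symmetric] less_eq_complex_def cmod_power2)
  then show ?thesis by simp
qed (use diag l in simp)

text \<open>
  Rank-revealing Cholesky factorisation: each step splits off a rank-one matrix through a nonzero
  diagonal entry \<open>A l l\<close>. The remaining columns of \<open>R\<close> vanish in row \<open>l\<close>, so \<open>S\<close> is extended by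
  a multiple of the unit row vector \<open>l\<close>.
\<close>

lemma psd_factor_aux:
  fixes A :: "nat \<Rightarrow> nat \<Rightarrow> complex"
  assumes "\<And>i j. i < d \<Longrightarrow> j < d \<Longrightarrow> cnj (A j i) = A i j"
    and "\<And>v. 0 \<le> (\<Sum>i<d. \<Sum>j<d. A i j * v j * cnj (v i))"
  shows "\<exists>(r :: nat) R S. (\<forall>i<d. \<forall>j<d. A i j = (\<Sum>k<r. R i k * cnj (R j k))) \<and>
    (\<forall>k<r. \<forall>l<r. (\<Sum>i<d. S k i * R i l) = (if k = l then 1 else (0 :: complex)))"
  using assms
\<comment> \<open>The measure counts nonzero diagonal entries: a pivot step clears entry
  \<open>l\<close> and creates no new ones.\<close>
proof (induction "card {i. i < d \<and> A i i \<noteq> 0}" arbitrary: A rule: less_induct)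
  case less
  note herm = less.prems(1) and pos = less.prems(2)
  show ?case
  proof (cases "\<exists>l<d. A l l \<noteq> 0")
    case False
    then have *: "\<forall>i<d. \<forall>j<d. A i j = 0"
      using psd_zero_diag[OF herm pos] by blast
    show ?thesis
      by (rule exI[of _ "0 :: nat"]) (simp add: *)
  next
    case True
    then obtain l where l: "l < d" "A l l \<noteq> 0" by blast
    define B where "B i j = A i j - A i l * A l j / A l l" for i j
    have B_herm: "cnj (B j i) = B i j" if "i < d" "j < d" for i j
      using that l herm[OF that] herm[OF l(1) l(1)] herm[OF that(1) l(1)] herm[OF l(1) that(2)]
      by (simp add: B_def mult.commute)
    have B_pos: "0 \<le> (\<Sum>i<d. \<Sum>j<d. B i j * v j * cnj (v i))" for v
      unfolding B_def by (rule psd_pivot[OF pos l])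
    \<comment> \<open>If \<open>A i i = 0\<close>, then \<open>B i i * A l l\<close> is minus the
      squared modulus of \<open>A i l\<close>. Both factors are nonnegative, so
      \<open>A i l = 0\<close> and entry \<open>i\<close> stays zero.\<close>
    have diag: "B i i = 0" if "A i i = 0" "i < d" for i
    proof -
      have "0 \<le> A l l" "0 \<le> B i i"
        using psd_diag_nonneg[OF pos l(1)] psd_diag_nonneg[OF B_pos that(2)] by auto
      moreover have "B i i * A l l = - complex_of_real ((cmod (A i l))\<^sup>2)"
        using that herm[OF l(1) that(2), symmetric] l
        by (simp add: B_def complex_norm_square[symmetric])
      ultimately have "0 \<le> - complex_of_real ((cmod (A i l))\<^sup>2)"
        by (metis mult_nonneg_nonneg)
      then have "A i l = 0" by (simp add: less_eq_complex_def)
      then show ?thesis using that by (simp add: B_def)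
    qed
    have B_l: "B l l = 0" by (simp add: B_def)
    have "{i. i < d \<and> B i i \<noteq> 0} \<subset> {i. i < d \<and> A i i \<noteq> 0}"
      using diag B_l l by auto
    then have "card {i. i < d \<and> B i i \<noteq> 0} < card {i. i < d \<and> A i i \<noteq> 0}"
      by (rule psubset_card_mono[rotated]) simp
    then have "\<exists>(r :: nat) R S. (\<forall>i<d. \<forall>j<d. B i j = (\<Sum>k<r. R i k * cnj (R j k))) \<and>
      (\<forall>k<r. \<forall>l<r. (\<Sum>i<d. S k i * R i l) = (if k = l then 1 else (0 :: complex)))"
      by (rule less.hyps) (fact B_herm B_pos)+
    then obtain r :: nat and R S :: "nat \<Rightarrow> nat \<Rightarrow> complex" where
      R: "\<forall>i<d. \<forall>j<d. B i j = (\<Sum>k<r. R i k * cnj (R j k))" and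
      S: "\<forall>k<r. \<forall>l<r. (\<Sum>i<d. S k i * R i l) = (if k = l then 1 else 0)"
      by (elim exE conjE) (rule that)
    note R = R[rule_format] and S = S[rule_format]
    \<comment> \<open>The entry \<open>B l l = 0\<close> is the sum of the squared moduli of row
      \<open>l\<close> of \<open>R\<close>.\<close>
    have R_l: "R l k = 0" if "k < r" for k
    proof -
      have "(\<Sum>k<r. R l k * cnj (R l k)) = 0"
        using R[OF l(1) l(1)] B_l by simp
      then have "\<forall>k\<in>{..<r}. R l k * cnj (R l k) = 0"
        by (subst (asm) sum_nonneg_eq_0_iff)
          (auto simp: less_eq_complex_def)
      then show ?thesis using that by auto
    qed
    define s where "s = complex_of_real (sqrt (Re (A l l)))"
    have s: "s * s = A l l" "cnj s = s" "s \<noteq> 0"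
    proof -
      have "0 \<le> A l l" by (rule psd_diag_nonneg[OF pos l(1)])
      then have *: "complex_of_real (Re (A l l)) = A l l" "0 \<le> Re (A l l)"
        by (auto simp: less_eq_complex_def complex_eq_iff)
      then show "s * s = A l l" "cnj s = s"
        by (simp_all add: s_def of_real_mult[symmetric] del: of_real_mult)
      with l show "s \<noteq> 0" by auto
    qed
    define R' where "R' i k = (if k < r then R i k else A i l / s)" for i k
    \<comment> \<open>The correction of the old rows at coordinate \<open>l\<close> cancels their
      product with the new column, whose entry in row \<open>l\<close> is
      \<open>A l l / s = s\<close>. It does not affect the old columns, which vanish there by
      \<open>R_l\<close>.\<close>
    define S' where "S' k i = (if k < r then S k i - (if i = l then (\<Sum>j<d. S k j * A j l) / A l l else 0)
      else if i = l then 1 / s else 0)" for k i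
    have "A i j = (\<Sum>k<Suc r. R' i k * cnj (R' j k))" if "i < d" "j < d" for i j
    proof -
      have "A i l / s * cnj (A j l / s) = A i l * A l j / A l l"
        using s herm[OF l(1) that(2)] by (simp add: mult_ac)
      moreover have "(\<Sum>k<Suc r. R' i k * cnj (R' j k)) = B i j + A i l / s * cnj (A j l / s)"
        using R[OF that] by (simp add: R'_def)
      ultimately show ?thesis
        by (simp only: B_def diff_add_cancel)
    qed
    moreover have "(\<Sum>i<d. S' k i * R' i k') = (if k = k' then 1 else 0)" if k: "k < Suc r" "k' < Suc r" for k k'
    proof (cases "k < r")
      case True
      have "(\<Sum>i<d. S' k i * R' i k') = (\<Sum>i<d. S k i * R' i k' -
          (if i = l then (\<Sum>j<d. S k j * A j l) / A l l * R' l k' else 0))"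
        using True by (intro sum.cong refl) (auto simp: S'_def algebra_simps)
      also have "\<dots> = (\<Sum>i<d. S k i * R' i k') - (\<Sum>j<d. S k j * A j l) / A l l * R' l k'"
        using l by (simp add: sum_subtractf)
      finally have *: "(\<Sum>i<d. S' k i * R' i k') =
        (\<Sum>i<d. S k i * R' i k') - (\<Sum>j<d. S k j * A j l) / A l l * R' l k'" .
      show ?thesis
      proof (cases "k' < r")
        case True
        then show ?thesis
          unfolding * using \<open>k < r\<close> S[OF \<open>k < r\<close> True] R_l by (simp add: R'_def)
      next
        case False
        then show ?thesis
          unfolding * using \<open>k < r\<close> k l s by (simp add: R'_def sum_divide_distrib[symmetric])
      qed
    next
      case False
      have "(\<Sum>i<d. S' k i * R' i k') = (\<Sum>i<d. if i = l then R' l k' / s else 0)"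
        using False by (intro sum.cong refl) (auto simp: S'_def)
      also have "\<dots> = R' l k' / s" using l by simp
      also have "\<dots> = (if k = k' then 1 else 0)"
        using False k R_l s l by (auto simp: R'_def less_Suc_eq)
      finally show ?thesis .
    qed
    ultimately show ?thesis by blast
  qed
qed

text \<open>The left inverse \<open>S\<close> expresses that the columns of \<open>R\<close> are
  independent, so that \<open>R * S\<close> fixes the range of \<open>A\<close>. This factorisation
  takes the place of a spectral decomposition.\<close>

theorem psd_factor:
  fixes A :: "complex mat"
  assumes "psd d A"
  obtains r R S where "R \<in> carrier_mat d r" "S \<in> carrier_mat r d"
    "A = R * mat_adjoint R" "S * R = 1\<^sub>m r"
proof -
  note A = psd_carrier[OF assms]
  have "\<exists>(r :: nat) R S. (\<forall>i<d. \<forall>j<d. A $$ (i, j) = (\<Sum>k<r. R i k * cnj (R j k))) \<and>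
    (\<forall>k<r. \<forall>l<r. (\<Sum>i<d. S k i * R i l) = (if k = l then 1 else (0 :: complex)))"
    by (rule psd_factor_aux)
      (use psd_conjugate_index[OF assms] psd_quadratic_form[OF assms] in simp_all)
  then obtain r :: nat and R S :: "nat \<Rightarrow> nat \<Rightarrow> complex" where
    RS: "\<forall>i<d. \<forall>j<d. A $$ (i, j) = (\<Sum>k<r. R i k * cnj (R j k))"
    "\<forall>k<r. \<forall>l<r. (\<Sum>i<d. S k i * R i l) = (if k = l then 1 else 0)"
    by (elim exE conjE) (rule that)
  note RS = RS[rule_format]
  define R' where "R' = mat d r (\<lambda>(i, k). R i k)"
  define S' where "S' = mat r d (\<lambda>(k, i). S k i)"
  have c: "R' \<in> carrier_mat d r" "S' \<in> carrier_mat r d" by (auto simp: R'_def S'_def)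
  note c' = mat_adjoint_carrier[OF c(1)]
  have "(R' * mat_adjoint R') $$ (i, j) = A $$ (i, j)" if "i < d" "j < d" for i j
    unfolding mat_mult_index[OF c(1) c' that] RS(1)[OF that]
    by (intro sum.cong refl) (use that in \<open>simp add: mat_adjoint_index[OF c(1)], simp add: R'_def\<close>)
  then have "A = R' * mat_adjoint R'"
    using A c c' by (intro eq_matI) (auto simp del: index_mult_mat(1))
  moreover have "(S' * R') $$ (k, l) = (if k = l then 1 else 0)" if "k < r" "l < r" for k l
    unfolding mat_mult_index[OF c(2,1) that] RS(2)[OF that, symmetric]
    by (intro sum.cong refl) (use that in \<open>simp add: R'_def S'_def\<close>)
  then have "S' * R' = 1\<^sub>m r"
    using c by (intro eq_matI) (auto simp del: index_mult_mat(1))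
  ultimately show ?thesis using c that by blast
qed

text \<open>The trace is the sum of the squared moduli of the entries of \<open>T\<close>.\<close>

lemma trace_mult_adjoint:
  fixes T :: "complex mat"
  assumes T: "T \<in> carrier_mat r s"
  shows "0 \<le> mat_trace (T * mat_adjoint T)"
    and "mat_trace (T * mat_adjoint T) = 0 \<Longrightarrow> T = 0\<^sub>m r s"
proof -
  have "mat_trace (T * mat_adjoint T) = (\<Sum>i<r. \<Sum>j<s. of_real ((cmod (T $$ (i, j)))\<^sup>2))"
    unfolding trace_mult[OF T mat_adjoint_carrier[OF T]]
    by (intro sum.cong refl) (simp add: mat_adjoint_index[OF T] complex_norm_square[symmetric])
  then have tr: "mat_trace (T * mat_adjoint T) = of_real (\<Sum>i<r. \<Sum>j<s. (cmod (T $$ (i, j)))\<^sup>2)"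
    by simp
  have "0 \<le> (\<Sum>i<r. \<Sum>j<s. (cmod (T $$ (i, j)))\<^sup>2)"
    by (intro sum_nonneg) simp
  then show "0 \<le> mat_trace (T * mat_adjoint T)"
    unfolding tr by (simp only: less_eq_complex_def) simp
  assume "mat_trace (T * mat_adjoint T) = 0"
  then have "(\<Sum>i<r. \<Sum>j<s. (cmod (T $$ (i, j)))\<^sup>2) = 0"
    unfolding tr by (simp only: of_real_eq_0_iff)
  then have "\<forall>i<r. \<forall>j<s. T $$ (i, j) = 0"
    by (simp add: sum_nonneg_eq_0_iff sum_nonneg)
  then show "T = 0\<^sub>m r s" using T by (intro eq_matI) auto
qed

text \<open>Factor \<open>A = R * mat_adjoint R\<close> and \<open>B = Q * mat_adjoint Q\<close>,
  and put \<open>T = mat_adjoint R * Q\<close>. Cyclicity turns the trace into that of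
  \<open>T * mat_adjoint T\<close>, and \<open>A * B\<close> contains \<open>T\<close> as a
  factor.\<close>

lemma trace_mult_psd:
  fixes A B :: "complex mat"
  assumes A: "psd d A" and B: "psd d B"
  shows "0 \<le> mat_trace (A * B)"
    and "mat_trace (A * B) = 0 \<Longrightarrow> A * B = 0\<^sub>m d d"
proof -
  obtain r R where R: "R \<in> carrier_mat d r" and A_eq: "A = R * mat_adjoint R"
    using psd_factor[OF A] by metis
  obtain s Q where Q: "Q \<in> carrier_mat d s" and B_eq: "B = Q * mat_adjoint Q"
    using psd_factor[OF B] by metis
  note c = R Q mat_adjoint_carrier[OF R] mat_adjoint_carrier[OF Q]
  define T where "T = mat_adjoint R * Q"
  have T: "T \<in> carrier_mat r s" unfolding T_def by (rule mult_carrier_mat[OF c(3,2)])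
  have T_adj: "mat_adjoint T = mat_adjoint Q * R"
    unfolding T_def mat_adjoint_mult[OF c(3,2)] by simp
  have AB: "A * B = R * (T * mat_adjoint Q)"
    unfolding A_eq B_eq T_def assoc_mult_mat[OF c(3,2,4)]
    by (rule assoc_mult_mat[OF c(1,3) mult_carrier_mat[OF c(2,4)]])
  have "mat_trace (A * B) = mat_trace (T * mat_adjoint Q * R)"
    unfolding AB by (rule trace_mult_commute[OF c(1) mult_carrier_mat[OF T c(4)]])
  also have "\<dots> = mat_trace (T * mat_adjoint T)"
    unfolding T_adj assoc_mult_mat[OF T c(4,1)] ..
  finally have tr: "mat_trace (A * B) = mat_trace (T * mat_adjoint T)" .
  show "0 \<le> mat_trace (A * B)"
    unfolding tr by (rule trace_mult_adjoint[OF T])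
  assume "mat_trace (A * B) = 0"
  then have "T = 0\<^sub>m r s"
    unfolding tr by (rule trace_mult_adjoint[OF T])
  then show "A * B = 0\<^sub>m d d" unfolding AB using c by simp
qed

text \<open>The traces of \<open>P * M a * mat_adjoint P\<close> are nonnegative and add up to 0, so
  each vanishes. Writing \<open>M a = R * mat_adjoint R\<close> then forces
  \<open>P * R = 0\<^sub>m d r\<close>.\<close>

lemma psd_sum_range:
  fixes M :: "'i \<Rightarrow> complex mat"
  assumes I: "finite I" and M: "\<And>a. a \<in> I \<Longrightarrow> psd d (M a)" and P: "P \<in> carrier_mat d d"
    and P_sum: "P * mat_sum d I M = 0\<^sub>m d d" and a: "a \<in> I"
  shows "P * M a = 0\<^sub>m d d"
proof -
  have P': "mat_adjoint P \<in> carrier_mat d d" using P by simp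
  have M': "M a \<in> carrier_mat d d" if "a \<in> I" for a using M[OF that] by (rule psd_carrier)
  have PMP: "mat_trace (P * M a * mat_adjoint P) = mat_trace (P * R * mat_adjoint (P * R))"
    if R: "R \<in> carrier_mat d r" "M a = R * mat_adjoint R" for a r R
  proof -
    note R' = mat_adjoint_carrier[OF R(1)]
    show ?thesis
      unfolding R(2) mat_adjoint_mult[OF P R(1)] assoc_mult_mat[OF P R(1) R', symmetric]
        assoc_mult_mat[OF mult_carrier_mat[OF P R(1)] R' P'] ..
  qed
  have nonneg: "0 \<le> mat_trace (P * M a * mat_adjoint P)" if a: "a \<in> I" for a
  proof -
    obtain r R where R: "R \<in> carrier_mat d r" "M a = R * mat_adjoint R"
      using psd_factor[OF M[OF a]] by metis
    show ?thesis
      unfolding PMP[OF R] by (rule trace_mult_adjoint[OF mult_carrier_mat[OF P R(1)]])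
  qed
  have "(\<Sum>a\<in>I. mat_trace (P * M a * mat_adjoint P)) = mat_trace (mat_sum d I (\<lambda>a. P * M a * mat_adjoint P))"
    by (rule trace_mat_sum[symmetric]) (use P P' M' in auto)
  also have "\<dots> = mat_trace (P * mat_sum d I M * mat_adjoint P)"
    by (subst mat_sum_congruence[OF M' P P']) auto
  also have "\<dots> = 0"
    unfolding P_sum using left_mult_zero_mat[OF P'] by (simp add: mat_trace_def)
  finally have "mat_trace (P * M a * mat_adjoint P) = 0"
    using I nonneg a by (simp add: sum_nonneg_eq_0_iff)
  moreover obtain r R where R: "R \<in> carrier_mat d r" "M a = R * mat_adjoint R"
    using psd_factor[OF M[OF a]] by metis
  ultimately have "mat_trace (P * R * mat_adjoint (P * R)) = 0"
    by (simp only: PMP[OF R, symmetric])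
  then have "P * R = 0\<^sub>m d r"
    by (rule trace_mult_adjoint(2)[OF mult_carrier_mat[OF P R(1)]])
  moreover have "P * M a = P * R * mat_adjoint R"
    unfolding R(2) by (rule assoc_mult_mat[symmetric, OF P R(1) mat_adjoint_carrier[OF R(1)]])
  ultimately show ?thesis using R(1) by simp
qed

section \<open>Bipartite vectors as matrices\<close>

lemma sum_lessThan_mult:
  fixes f :: "nat \<Rightarrow> 'a :: comm_monoid_add"
  shows "(\<Sum>p<m * n. f p) = (\<Sum>i<m. \<Sum>j<n. f (i * n + j))"
proof -
  have "(\<Sum>p<m * n. f p) = (\<Sum>i<m. sum f {i * n..<i * n + n})"
    by (simp add: sum.nat_group)
  also have "\<dots> = (\<Sum>i<m. \<Sum>j<n. f (i * n + j))"
  proof (rule sum.cong[OF refl])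
    show "sum f {i * n..<i * n + n} = (\<Sum>j<n. f (i * n + j))" for i
      using sum.shift_bounds_nat_ivl[of f 0 "i * n" n] by (simp add: lessThan_atLeast0 add.commute)
  qed
  finally show ?thesis .
qed

lemma index_pair_less: "(i :: nat) < m \<Longrightarrow> j < n \<Longrightarrow> i * n + j < m * n"
  using mult_le_mono1[of "Suc i" m n] by simp

text \<open>When vectors of the tensor product are read as matrices, \<open>kronecker X Y\<close>
  acts as \<open>K \<mapsto> X * K * transpose_mat Y\<close>, and the inner product with
  \<open>\<psi>\<close> becomes the trace against \<open>mat_adjoint K\<close>.\<close>

lemma expectation_value_kronecker:
  assumes \<psi>: "\<psi> \<in> carrier_vec (m * n)" and X: "X \<in> carrier_mat m m" and Y: "Y \<in> carrier_mat n n"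
    and K: "K = mat m n (\<lambda>(i, j). \<psi> $ (i * n + j))"
  shows "expectation_value \<psi> (kronecker X Y) = mat_trace (X * (K * transpose_mat Y * mat_adjoint K))"
proof -
  have Kc: "K \<in> carrier_mat m n" and Yc: "transpose_mat Y \<in> carrier_mat n n"
    using K Y by auto
  have XY: "kronecker X Y \<in> carrier_mat (m * n) (m * n)"
    using X Y by (auto simp: kronecker_def)
  have ent: "kronecker X Y $$ (i * n + j, i' * n + j') = X $$ (i, i') * Y $$ (j, j')"
    if "i < m" "i' < m" "j < n" "j' < n" for i j i' j'
    using that X Y by (simp add: kronecker_def index_pair_less)
  have Kent: "K $$ (i, j) = \<psi> $ (i * n + j)" if "i < m" "j < n" for i j
    using that by (simp add: K)
  have "expectation_value \<psi> (kronecker X Y) =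
      (\<Sum>p<m * n. \<Sum>q<m * n. kronecker X Y $$ (p, q) * \<psi> $ q * cnj (\<psi> $ p))"
    unfolding expectation_value_def using XY \<psi>
    by (simp add: cscalar_prod_sum[OF \<psi>] mat_mult_vec_index[OF XY] sum_distrib_right
        del: index_mult_mat_vec)
  also have "\<dots> = (\<Sum>i<m. \<Sum>j<n. \<Sum>i'<m. \<Sum>j'<n.
      X $$ (i, i') * Y $$ (j, j') * K $$ (i', j') * cnj (K $$ (i, j)))"
    unfolding sum_lessThan_mult by (intro sum.cong refl) (simp add: ent Kent)
  also have "\<dots> = (\<Sum>i<m. \<Sum>i'<m. \<Sum>j<n. \<Sum>j'<n.
      X $$ (i, i') * Y $$ (j, j') * K $$ (i', j') * cnj (K $$ (i, j)))"
    by (rule sum.cong[OF refl], rule sum.swap)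
  also have "\<dots> = (\<Sum>i<m. \<Sum>i'<m. X $$ (i, i') * (K * transpose_mat Y * mat_adjoint K) $$ (i', i))"
  proof (intro sum.cong refl)
    fix i i' assume "i \<in> {..<m}" "i' \<in> {..<m}"
    then have i: "i < m" "i' < m" by auto
    have "(K * transpose_mat Y * mat_adjoint K) $$ (i', i) =
        (\<Sum>j<n. (\<Sum>j'<n. K $$ (i', j') * Y $$ (j, j')) * cnj (K $$ (i, j)))"
      unfolding mat_mult_index[OF mult_carrier_mat[OF Kc Yc] mat_adjoint_carrier[OF Kc] i(2,1)]
      by (intro sum.cong refl)
        (use i Y in \<open>simp add: mat_mult_index[OF Kc Yc] mat_adjoint_index[OF Kc] del: index_mult_mat\<close>)
    then show "(\<Sum>j<n. \<Sum>j'<n. X $$ (i, i') * Y $$ (j, j') * K $$ (i', j') * cnj (K $$ (i, j))) =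
        X $$ (i, i') * (K * transpose_mat Y * mat_adjoint K) $$ (i', i)"
      by (simp add: sum_distrib_left sum_distrib_right mult_ac)
  qed
  also have "\<dots> = mat_trace (X * (K * transpose_mat Y * mat_adjoint K))"
    by (rule trace_mult[symmetric, OF X]) (use Kc Yc in auto)
  finally show ?thesis .
qed

lemma cscalar_prod_self_trace:
  assumes \<psi>: "\<psi> \<in> carrier_vec (m * n)" and K: "K = mat m n (\<lambda>(i, j). \<psi> $ (i * n + j))"
  shows "\<psi> \<bullet>c \<psi> = mat_trace (K * mat_adjoint (K :: complex mat))"
proof -
  have Kc: "K \<in> carrier_mat m n" using K by simp
  show ?thesis
    unfolding trace_mult[OF Kc mat_adjoint_carrier[OF Kc]] cscalar_prod_sum[OF \<psi>] sum_lessThan_mult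
    by (intro sum.cong refl) (simp add: mat_adjoint_index[OF Kc], simp add: K)
qed

section \<open>Products and scalings of sums of matrices\<close>

lemma mat_sum_mult_left:
  fixes B :: "'a :: comm_ring_1 mat"
  assumes X: "\<And>a. a \<in> I \<Longrightarrow> X a \<in> carrier_mat d d" and B: "B \<in> carrier_mat d d"
  shows "B * mat_sum d I X = mat_sum d I (\<lambda>a. B * X a)"
proof -
  have "mat_sum d I (\<lambda>a. B * X a * 1\<^sub>m d) = mat_sum d I (\<lambda>a. B * X a)"
    by (rule mat_sum_cong) (simp add: right_mult_one_mat[OF mult_carrier_mat[OF B X]])
  then show ?thesis
    using mat_sum_congruence[OF X B one_carrier_mat, where I = I]
    by (simp add: right_mult_one_mat[OF mult_carrier_mat[OF B mat_sum_carrier]])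
qed

lemma mat_sum_single:
  assumes "finite I" "a \<in> I" "X a \<in> carrier_mat d d" "\<And>b. b \<in> I \<Longrightarrow> b \<noteq> a \<Longrightarrow> X b = 0\<^sub>m d d"
  shows "mat_sum d I X = X a"
proof -
  have "(\<Sum>b\<in>I. X b $$ (i, j)) = X a $$ (i, j)" if "i < d" "j < d" for i j
    using assms that by (subst sum.remove[of I a]) (auto intro!: sum.neutral)
  then show ?thesis
    using assms(3) by (intro eq_matI) (auto simp: mat_sum_def)
qed

lemma sum_trace_mult:
  fixes A :: "'b \<Rightarrow> 'a :: comm_ring_1 mat"
  assumes A: "\<And>a. a \<in> I \<Longrightarrow> A a \<in> carrier_mat d d" and B: "\<And>b. b \<in> J \<Longrightarrow> B b \<in> carrier_mat d d"
  shows "(\<Sum>a\<in>I. \<Sum>b\<in>J. mat_trace (A a * B b)) = mat_trace (mat_sum d I A * mat_sum d J B)"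
proof -
  have "(\<Sum>b\<in>J. mat_trace (A a * B b)) = mat_trace (A a * mat_sum d J B)" if "a \<in> I" for a
    using A B that by (subst mat_sum_mult_left) (auto intro!: trace_mat_sum[symmetric] mult_carrier_mat[of _ d d])
  then have "(\<Sum>a\<in>I. \<Sum>b\<in>J. mat_trace (A a * B b)) = (\<Sum>a\<in>I. mat_trace (A a * mat_sum d J B))"
    by simp
  also have "\<dots> = mat_trace (mat_sum d I A * mat_sum d J B)"
    using A by (subst mat_sum_mult_right) (auto intro!: trace_mat_sum[symmetric] mult_carrier_mat[of _ d d])
  finally show ?thesis .
qed

text \<open>Nonnegativity of \<open>c\<close> enters through its action, so that both the complex
  rescaling of a strategy and the real rescaling of Gram matrices are instances.\<close>

lemma psd_smult:
  fixes A :: "'a :: conjugatable_ordered_field mat"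
  assumes A: "psd d A" and c: "conjugate c = c" "\<And>x. 0 \<le> x \<Longrightarrow> 0 \<le> c * x"
  shows "psd d (c \<cdot>\<^sub>m A)"
proof -
  have "(\<Sum>i<d. \<Sum>j<d. (c \<cdot>\<^sub>m A) $$ (i, j) * v j * conjugate (v i)) =
      c * (\<Sum>i<d. \<Sum>j<d. A $$ (i, j) * v j * conjugate (v i))" for v
    using psd_carrier[OF A] by (simp add: sum_distrib_left mult.assoc)
  then show ?thesis
    using psd_carrier[OF A] psd_quadratic_form[OF A] psd_conjugate_index[OF A] c
    by (subst psd_index) (auto simp: conjugate_dist_mul)
qed

lemma trace_smult_mult:
  fixes A B :: "'a :: comm_ring_1 mat"
  assumes A: "A \<in> carrier_mat d d" and B: "B \<in> carrier_mat d d"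
  shows "mat_trace ((c \<cdot>\<^sub>m A) * (c \<cdot>\<^sub>m B)) = c * c * mat_trace (A * B)"
  using A B
  by (simp add: trace_mult[of _ d d] sum_distrib_left mult_ac del: index_mult_mat)

lemma mat_sum_smult:
  fixes X :: "'i \<Rightarrow> 'a :: comm_ring_1 mat"
  assumes "\<And>a. a \<in> I \<Longrightarrow> X a \<in> carrier_mat d d"
  shows "mat_sum d I (\<lambda>a. c \<cdot>\<^sub>m X a) = c \<cdot>\<^sub>m mat_sum d I X"
proof -
  have "(c \<cdot>\<^sub>m X a) $$ (i, j) = c * X a $$ (i, j)" if "a \<in> I" "i < d" "j < d" for a i j
    using assms[OF that(1)] that by simp
  then show ?thesis
    by (intro eq_matI) (auto simp: mat_sum_def sum_distrib_left intro!: sum.cong)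
qed

section \<open>Perfect strategies for homomorphism games\<close>

text \<open>Shorthand for a losing round, where \<open>verdict\<close> is 0. The questions come
  before the answers, opposite to the order in \<open>verdict\<close>.\<close>

definition forbidden ::
  "'h pair_pre_digraph \<Rightarrow> 'g pair_pre_digraph \<Rightarrow> 'h \<Rightarrow> 'h \<Rightarrow> 'g \<Rightarrow> 'g \<Rightarrow> bool" where
  "forbidden H G h h' g g' \<longleftrightarrow>
     (h = h' \<and> g \<noteq> g') \<or> ((h, h') \<in> parcs H \<and> ((g, g') \<notin> parcs G \<or> g = g'))"

text \<open>The value is 1 minus the average losing probability, a sum of nonnegative terms, so it
  is 1 exactly if all of them vanish. Keeping \<open>p\<close> abstract lets both directions of the
  equivalence use this.\<close>

lemma hom_game_value_eq_1_iff:
  fixes p :: "'h \<Rightarrow> 'h \<Rightarrow> 'g \<Rightarrow> 'g \<Rightarrow> complex"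
  assumes H: "finite (pverts H)" "pverts H \<noteq> {}" "parcs H \<subseteq> pverts H \<times> pverts H"
    and G: "finite (pverts G)"
    and nonneg: "\<And>s t a b. s \<in> pverts H \<Longrightarrow> t \<in> pverts H \<Longrightarrow> a \<in> pverts G \<Longrightarrow> b \<in> pverts G \<Longrightarrow> 0 \<le> p s t a b"
    and total: "\<And>s t. s \<in> pverts H \<Longrightarrow> t \<in> pverts H \<Longrightarrow> (\<Sum>a \<in> pverts G. \<Sum>b \<in> pverts G. p s t a b) = 1"
  shows "(\<Sum>s \<in> questions1 (hom_game H G). \<Sum>t \<in> questions2 (hom_game H G).
      complex_of_real (distr (hom_game H G) s t) *
        (\<Sum>a \<in> answers1 (hom_game H G). \<Sum>b \<in> answers2 (hom_game H G).
          complex_of_real (verdict (hom_game H G) a b s t) * p s t a b)) = 1 \<longleftrightarrow>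
    (\<forall>s \<in> pverts H. \<forall>t \<in> pverts H. \<forall>a \<in> pverts G. \<forall>b \<in> pverts G. forbidden H G s t a b \<longrightarrow> p s t a b = 0)"
    (is "?value = 1 \<longleftrightarrow> ?zero")
proof -
  define V where "V = pverts H"
  define W where "W = pverts G"
  define Q where "Q = hom_game_questions H"
  define \<pi> where "\<pi> s t = complex_of_real (if (s, t) \<in> Q then 1 / real (card Q) else 0)" for s t
  \<comment> \<open>\<open>L s t\<close> is the probability of losing once \<open>s\<close> and
    \<open>t\<close> are asked.\<close>
  define L where "L s t = (\<Sum>a\<in>W. \<Sum>b\<in>W. if forbidden H G s t a b then p s t a b else 0)" for s t
  have Q: "Q \<subseteq> V \<times> V" "Q \<noteq> {}"
    using H by (auto simp: Q_def V_def hom_game_questions_def)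
  have fin: "finite V" "finite W" "finite Q"
    using H G finite_subset[OF Q(1)] by (auto simp: V_def W_def)
  have "(\<Sum>st\<in>V \<times> V. (if st \<in> Q then 1 / real (card Q) else 0)) = 1"
    using fin Q by (simp add: sum.If_cases Int_absorb1)
  then have "(\<Sum>s\<in>V. \<Sum>t\<in>V. (if (s, t) \<in> Q then 1 / real (card Q) else 0)) = 1"
    by (simp add: sum.cartesian_product split_def)
  then have \<pi>_total: "(\<Sum>s\<in>V. \<Sum>t\<in>V. \<pi> s t) = 1"
    unfolding \<pi>_def of_real_sum[symmetric] by (simp only: of_real_1)
  have \<pi>_nonneg: "0 \<le> \<pi> s t" for s t
    by (simp add: \<pi>_def less_eq_complex_def)
  have L_nonneg: "0 \<le> L s t" if "s \<in> V" "t \<in> V" for s t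
    using nonneg that unfolding L_def V_def W_def by (intro sum_nonneg) auto
  have won: "(\<Sum>a\<in>W. \<Sum>b\<in>W. complex_of_real (if forbidden H G s t a b then 0 else 1) * p s t a b) = 1 - L s t"
    if "s \<in> V" "t \<in> V" for s t
  proof -
    have "(\<Sum>a\<in>W. \<Sum>b\<in>W. complex_of_real (if forbidden H G s t a b then 0 else 1) * p s t a b) + L s t =
        (\<Sum>a\<in>W. \<Sum>b\<in>W. p s t a b)"
      unfolding L_def sum.distrib[symmetric] by (intro sum.cong refl) auto
    then show ?thesis
      using total that by (simp add: V_def W_def eq_diff_eq)
  qed
  have "?value = (\<Sum>s\<in>V. \<Sum>t\<in>V. \<pi> s t *
      (\<Sum>a\<in>W. \<Sum>b\<in>W. complex_of_real (if forbidden H G s t a b then 0 else 1) * p s t a b))"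
    by (simp only: hom_game_def V_def W_def \<pi>_def Q_def forbidden_def nonlocal_game.select_convs)
  also have "\<dots> = (\<Sum>s\<in>V. \<Sum>t\<in>V. \<pi> s t - \<pi> s t * L s t)"
    by (intro sum.cong refl) (simp only: won right_diff_distrib mult_1_right)
  also have "\<dots> = 1 - (\<Sum>s\<in>V. \<Sum>t\<in>V. \<pi> s t * L s t)"
    by (simp add: sum_subtractf \<pi>_total)
  finally have "?value = 1 \<longleftrightarrow> (\<Sum>s\<in>V. \<Sum>t\<in>V. \<pi> s t * L s t) = 0"
    by simp
  also have "\<dots> \<longleftrightarrow> (\<forall>s\<in>V. \<forall>t\<in>V. \<pi> s t * L s t = 0)"
    using fin \<pi>_nonneg L_nonneg by (subst sum_nonneg_eq_0_iff, simp, force intro: sum_nonneg)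
      (auto simp: sum_nonneg_eq_0_iff)
  also have "\<dots> \<longleftrightarrow> (\<forall>s\<in>V. \<forall>t\<in>V. (s, t) \<in> Q \<longrightarrow> L s t = 0)"
    using fin Q by (auto simp: \<pi>_def)
  also have "\<dots> \<longleftrightarrow> (\<forall>s\<in>V. \<forall>t\<in>V. L s t = 0)"
  proof -
    have "L s t = 0" if "s \<in> V" "(s, t) \<notin> Q" for s t
    proof -
      have "\<not> forbidden H G s t a b" for a b
        using that by (auto simp: Q_def V_def hom_game_questions_def forbidden_def)
      then show ?thesis by (simp add: L_def)
    qed
    then show ?thesis by blast
  qed
  also have "\<dots> \<longleftrightarrow> ?zero"
  proof -
    have "L s t = 0 \<longleftrightarrow> (\<forall>a\<in>W. \<forall>b\<in>W. forbidden H G s t a b \<longrightarrow> p s t a b = 0)"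
      if "s \<in> V" "t \<in> V" for s t
    proof -
      have n: "0 \<le> (if forbidden H G s t a b then p s t a b else 0)" if "a \<in> W" "b \<in> W" for a b
        using nonneg that \<open>s \<in> V\<close> \<open>t \<in> V\<close> by (simp add: V_def W_def)
      have "L s t = 0 \<longleftrightarrow> (\<forall>a\<in>W. (\<Sum>b\<in>W. if forbidden H G s t a b then p s t a b else 0) = 0)"
        unfolding L_def using fin(2) n by (intro sum_nonneg_eq_0_iff sum_nonneg) auto
      also have "\<dots> \<longleftrightarrow> (\<forall>a\<in>W. \<forall>b\<in>W. (if forbidden H G s t a b then p s t a b else 0) = 0)"
        using fin(2) n by (intro ball_cong refl sum_nonneg_eq_0_iff) auto
      finally show ?thesis by auto
    qed
    then show ?thesis by (simp add: V_def W_def)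
  qed
  finally show ?thesis .
qed

text \<open>The middle term between strategies and feasible Gram matrices. \<open>A\<close> has
  Frobenius norm 1, rather than trace 1 like a density matrix, to match
  \<open>X None None = 1\<close>.\<close>

definition psd_hom :: "'h pair_pre_digraph \<Rightarrow> 'g pair_pre_digraph \<Rightarrow> bool" where
  "psd_hom H G \<longleftrightarrow> (\<exists>d (A :: complex mat) M. psd d A \<and> mat_trace (A * A) = 1 \<and>
     (\<forall>h \<in> pverts H. \<forall>g \<in> pverts G. psd d (M h g)) \<and>
     (\<forall>h \<in> pverts H. mat_sum d (pverts G) (M h) = A) \<and>
     (\<forall>h \<in> pverts H. \<forall>h' \<in> pverts H. \<forall>g \<in> pverts G. \<forall>g' \<in> pverts G.
       forbidden H G h h' g g' \<longrightarrow> mat_trace (M h g * M h' g') = 0))"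

lemma measurement_mat_sum:
  "measurement d I X \<longleftrightarrow> (\<forall>a \<in> I. psd d (X a)) \<and> mat_sum d I X = 1\<^sub>m d"
  by (simp add: measurement_def mat_sum_def)

lemma mat_sum_transpose:
  assumes "\<And>a. a \<in> I \<Longrightarrow> X a \<in> carrier_mat d d"
  shows "mat_sum d I (\<lambda>a. transpose_mat (X a)) = transpose_mat (mat_sum d I X)"
proof -
  have "transpose_mat (X a) $$ (i, j) = X a $$ (j, i)" if "a \<in> I" "i < d" "j < d" for a i j
    using assms[OF that(1)] that by simp
  then show ?thesis
    by (intro eq_matI) (auto simp: mat_sum_def intro!: sum.cong)
qed

section \<open>From perfect strategies to orthogonal positive semidefinite matrices\<close>

lemma psd_hom_if_perfect:
  assumes H: "finite (pverts H)" "pverts H \<noteq> {}" "parcs H \<subseteq> pverts H \<times> pverts H"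
    and G: "finite (pverts G)"
    and perfect: "perfect_quantum_strategy (hom_game H G)"
  shows "psd_hom H G"
proof -
  define V where "V = pverts H"
  define W where "W = pverts G"
  from perfect obtain m n \<psi> X Y where
    \<psi>: "\<psi> \<in> carrier_vec (m * n)" "\<psi> \<bullet>c \<psi> = 1"
    and "\<forall>s \<in> V. measurement m W (X s)" "\<forall>t \<in> V. measurement n W (Y t)"
    and val: "(\<Sum>s \<in> questions1 (hom_game H G). \<Sum>t \<in> questions2 (hom_game H G).
        complex_of_real (distr (hom_game H G) s t) *
        (\<Sum>a \<in> answers1 (hom_game H G). \<Sum>b \<in> answers2 (hom_game H G).
          complex_of_real (verdict (hom_game H G) a b s t) *
            expectation_value \<psi> (kronecker (X s a) (Y t b)))) = 1"
    unfolding perfect_quantum_strategy_def by (auto simp: V_def W_def hom_game_def)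
  then have X: "\<And>s a. s \<in> V \<Longrightarrow> a \<in> W \<Longrightarrow> psd m (X s a)" "\<And>s. s \<in> V \<Longrightarrow> mat_sum m W (X s) = 1\<^sub>m m"
    and Y: "\<And>t b. t \<in> V \<Longrightarrow> b \<in> W \<Longrightarrow> psd n (Y t b)" "\<And>t. t \<in> V \<Longrightarrow> mat_sum n W (Y t) = 1\<^sub>m n"
    by (auto simp: measurement_mat_sum)
  have fin: "finite W" using G by (simp add: W_def)
  define K where "K = mat m n (\<lambda>(i, j). \<psi> $ (i * n + j))"
  \<comment> \<open>\<open>\<rho>\<close> is the reduced state of the first player, and
    \<open>N t b\<close> the unnormalised state left to that player when the second one answers
    \<open>b\<close> to \<open>t\<close>.\<close>
  define \<rho> where "\<rho> = K * mat_adjoint K"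
  define N where "N t b = K * transpose_mat (Y t b) * mat_adjoint K" for t b
  have K: "K \<in> carrier_mat m n" by (simp add: K_def)
  note K' = mat_adjoint_carrier[OF K]
  have \<rho>: "\<rho> \<in> carrier_mat m m" unfolding \<rho>_def by (rule mult_carrier_mat[OF K K'])
  have Xc: "X s a \<in> carrier_mat m m" if "s \<in> V" "a \<in> W" for s a
    using X(1)[OF that] by (rule psd_carrier)
  have Yc: "Y s a \<in> carrier_mat n n" if "s \<in> V" "a \<in> W" for s a
    using Y(1)[OF that] by (rule psd_carrier)
  have N_psd: "psd m (N t b)" if "t \<in> V" "b \<in> W" for t b
    unfolding N_def by (rule psd_congruence[OF psd_transpose[OF Y(1)[OF that]] K])
  have Nc: "N s a \<in> carrier_mat m m" if "s \<in> V" "a \<in> W" for s a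
    using N_psd[OF that] by (rule psd_carrier)
  have N_sum: "mat_sum m W (N t) = \<rho>" if t: "t \<in> V" for t
  proof -
    have "mat_sum m W (N t) = K * mat_sum n W (\<lambda>b. transpose_mat (Y t b)) * mat_adjoint K"
      unfolding N_def by (rule mat_sum_congruence[OF _ K K']) (use Yc[OF t] in auto)
    also have "mat_sum n W (\<lambda>b. transpose_mat (Y t b)) = 1\<^sub>m n"
      using mat_sum_transpose[of W "Y t", OF Yc[OF t]] Y(2)[OF t] by simp
    finally show ?thesis
      using K by (simp add: \<rho>_def)
  qed
  have \<rho>_psd: "psd m \<rho>"
    using psd_congruence[OF psd_one K] K by (simp add: \<rho>_def)
  have \<rho>_trace: "mat_trace \<rho> = 1"
    using cscalar_prod_self_trace[OF \<psi>(1) K_def] \<psi>(2) by (simp add: \<rho>_def)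
  have p: "expectation_value \<psi> (kronecker (X s a) (Y t b)) = mat_trace (X s a * N t b)"
    if "s \<in> V" "t \<in> V" "a \<in> W" "b \<in> W" for s t a b
    unfolding N_def by (rule expectation_value_kronecker[OF \<psi>(1) Xc Yc K_def]) (use that in auto)
  \<comment> \<open>The losing probabilities vanish and are traces of products of positive
    semidefinite matrices, so the products themselves are 0.\<close>
  have orth: "X s a * N t b = 0\<^sub>m m m"
    if "s \<in> V" "t \<in> V" "a \<in> W" "b \<in> W" "forbidden H G s t a b" for s t a b
  proof (rule trace_mult_psd(2)[OF X(1) N_psd])
    have "\<forall>s \<in> pverts H. \<forall>t \<in> pverts H. \<forall>a \<in> pverts G. \<forall>b \<in> pverts G. forbidden H G s t a b \<longrightarrow>
        expectation_value \<psi> (kronecker (X s a) (Y t b)) = 0"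
    proof (rule iffD1[OF hom_game_value_eq_1_iff[OF H G] val])
      fix s t assume st: "s \<in> pverts H" "t \<in> pverts H"
      then show "0 \<le> expectation_value \<psi> (kronecker (X s a) (Y t b))"
        if "a \<in> pverts G" "b \<in> pverts G" for a b
        using trace_mult_psd(1)[OF X(1) N_psd] that by (simp add: p V_def W_def)
      have "(\<Sum>a\<in>W. \<Sum>b\<in>W. mat_trace (X s a * N t b)) = mat_trace (1\<^sub>m m * \<rho>)"
        using st by (subst sum_trace_mult[of _ _ m]) (auto simp: V_def Xc Nc X N_sum)
      then show "(\<Sum>a\<in>pverts G. \<Sum>b\<in>pverts G. expectation_value \<psi> (kronecker (X s a) (Y t b))) = 1"
        using st \<rho> \<rho>_trace by (simp add: p V_def W_def)
    qed
    then show "mat_trace (X s a * N t b) = 0"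
      using that by (simp add: p V_def W_def)
  qed (use that in auto)
  \<comment> \<open>By consistency \<open>X s b * N s a\<close> vanishes for
    \<open>b \<noteq> a\<close>. Hence only one term survives when \<open>N s a\<close> is
    multiplied by the sum of all \<open>X s b\<close>, which is the identity, and when
    \<open>X s a\<close> is multiplied by \<open>\<rho>\<close>, the sum of all
    \<open>N s b\<close>.\<close>
  have XN: "X s a * N s a = N s a" "X s a * \<rho> = N s a" if sa: "s \<in> V" "a \<in> W" for s a
  proof -
    have "N s a = mat_sum m W (X s) * N s a"
      using X(2)[OF sa(1)] Nc[OF sa] by simp
    also have "\<dots> = mat_sum m W (\<lambda>b. X s b * N s a)"
      by (rule mat_sum_mult_right) (use sa Xc Nc in auto)
    also have "\<dots> = X s a * N s a"
      by (rule mat_sum_single[OF fin sa(2)])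
        (use sa Xc Nc in \<open>auto intro!: orth mult_carrier_mat[of _ m m] simp: forbidden_def\<close>)
    finally show 1: "X s a * N s a = N s a" ..
    have "X s a * \<rho> = mat_sum m W (\<lambda>b. X s a * N s b)"
      unfolding N_sum[OF sa(1), symmetric] by (rule mat_sum_mult_left) (use sa Xc Nc in auto)
    also have "\<dots> = X s a * N s a"
      by (rule mat_sum_single[OF fin sa(2)])
        (use sa Xc Nc in \<open>auto intro!: orth mult_carrier_mat[of _ m m] simp: forbidden_def\<close>)
    finally show "X s a * \<rho> = N s a" by (simp only: 1)
  qed
  \<comment> \<open>Taking adjoints in \<open>X s a * \<rho> = N s a\<close> gives
    \<open>N s a = \<rho> * X s a\<close>, so the product with \<open>N t b\<close> contains a
    factor that is 0 by \<open>orth\<close>.\<close>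
  have NN: "mat_trace (N s a * N t b) = 0"
    if "s \<in> V" "t \<in> V" "a \<in> W" "b \<in> W" "forbidden H G s t a b" for s t a b
  proof -
    note Xsa = Xc[OF that(1,3)] and Ntb = Nc[OF that(2,4)]
    have "N s a = mat_adjoint (X s a * \<rho>)"
      unfolding XN(2)[OF that(1,3)] using psd_adjoint[OF N_psd[OF that(1,3)]] ..
    also have "\<dots> = \<rho> * X s a"
      unfolding mat_adjoint_mult[OF Xsa \<rho>] psd_adjoint[OF \<rho>_psd] psd_adjoint[OF X(1)[OF that(1,3)]] ..
    finally have "N s a * N t b = \<rho> * (X s a * N t b)"
      by (simp only: assoc_mult_mat[OF \<rho> Xsa Ntb])
    also have "\<dots> = 0\<^sub>m m m"
      unfolding orth[OF that] using \<rho> by simp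
    finally show ?thesis by (simp add: mat_trace_def)
  qed
  \<comment> \<open>While \<open>\<rho>\<close> has trace 1, \<open>psd_hom\<close> asks for
    Frobenius norm 1. All matrices are therefore divided by \<open>sqrt \<tau>\<close>, which is
    positive because \<open>\<rho>\<close> is nonzero.\<close>
  define \<tau> where "\<tau> = Re (mat_trace (\<rho> * \<rho>))"
  have \<tau>: "mat_trace (\<rho> * \<rho>) = of_real \<tau>" "0 < \<tau>"
  proof -
    have *: "0 \<le> mat_trace (\<rho> * \<rho>)" by (rule trace_mult_psd[OF \<rho>_psd \<rho>_psd])
    then show "mat_trace (\<rho> * \<rho>) = of_real \<tau>"
      by (simp add: \<tau>_def less_eq_complex_def complex_eq_iff)
    have "mat_trace (\<rho> * \<rho>) \<noteq> 0"
    proof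
      assume "mat_trace (\<rho> * \<rho>) = 0"
      then have "\<rho> = 0\<^sub>m m m"
        using trace_mult_adjoint(2)[OF \<rho>] by (simp add: psd_adjoint[OF \<rho>_psd])
      then show False using \<rho>_trace by (simp add: mat_trace_def)
    qed
    with * show "0 < \<tau>"
      by (simp add: \<tau>_def less_eq_complex_def complex_eq_iff order_less_le)
  qed
  define c where "c = complex_of_real (1 / sqrt \<tau>)"
  have c: "cnj c = c" "0 \<le> c"
    using \<tau>(2) by (simp_all add: c_def less_eq_complex_def)
  have c': "psd m (c \<cdot>\<^sub>m B)" if "psd m B" for B
    by (rule psd_smult[OF that]) (use c in auto)
  have "c * c * of_real \<tau> = of_real (1 / sqrt \<tau> * (1 / sqrt \<tau>) * \<tau>)"
    by (simp only: c_def of_real_mult)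
  also have "1 / sqrt \<tau> * (1 / sqrt \<tau>) * \<tau> = 1"
    using \<tau>(2) by simp
  finally have cc: "c * c * of_real \<tau> = 1" by simp
  show ?thesis
    unfolding psd_hom_def V_def[symmetric] W_def[symmetric]
  proof (intro exI conjI ballI impI)
    show "psd m (c \<cdot>\<^sub>m \<rho>)" by (rule c'[OF \<rho>_psd])
    show "mat_trace ((c \<cdot>\<^sub>m \<rho>) * (c \<cdot>\<^sub>m \<rho>)) = 1"
      unfolding trace_smult_mult[OF \<rho> \<rho>] \<tau>(1) by (rule cc)
    show "psd m (c \<cdot>\<^sub>m N s a)" if "s \<in> V" "a \<in> W" for s a
      by (rule c'[OF N_psd[OF that]])
    show "mat_sum m W (\<lambda>a. c \<cdot>\<^sub>m N s a) = c \<cdot>\<^sub>m \<rho>" if "s \<in> V" for s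
      using mat_sum_smult[of W "N s", OF Nc[OF that]] N_sum[OF that] by simp
    show "mat_trace ((c \<cdot>\<^sub>m N s a) * (c \<cdot>\<^sub>m N t b)) = 0"
      if "s \<in> V" "t \<in> V" "a \<in> W" "b \<in> W" "forbidden H G s t a b" for s t a b
      unfolding trace_smult_mult[OF Nc[OF that(1,3)] Nc[OF that(2,4)]] NN[OF that] by simp
  qed
qed

section \<open>From positive semidefinite matrices to perfect strategies\<close>

lemma perfect_if_psd_hom:
  assumes H: "finite (pverts H)" "pverts H \<noteq> {}" "parcs H \<subseteq> pverts H \<times> pverts H"
    and G: "finite (pverts G)"
    and "psd_hom H G"
  shows "perfect_quantum_strategy (hom_game H G)"
proof -
  define V where "V = pverts H"
  define W where "W = pverts G"
  from assms(5) obtain d and A :: "complex mat" and M where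
    A: "psd d A" "mat_trace (A * A) = 1"
    and M: "\<And>h g. h \<in> V \<Longrightarrow> g \<in> W \<Longrightarrow> psd d (M h g)"
    and M_sum: "\<And>h. h \<in> V \<Longrightarrow> mat_sum d W (M h) = A"
    and M_orth: "\<And>h h' g g'. h \<in> V \<Longrightarrow> h' \<in> V \<Longrightarrow> g \<in> W \<Longrightarrow> g' \<in> W \<Longrightarrow>
      forbidden H G h h' g g' \<Longrightarrow> mat_trace (M h g * M h' g') = 0"
    unfolding psd_hom_def V_def[symmetric] W_def[symmetric] by blast
  have Ac: "A \<in> carrier_mat d d" by (rule psd_carrier[OF A(1)])
  have Mc: "M h g \<in> carrier_mat d d" if "h \<in> V" "g \<in> W" for h g
    using M[OF that] by (rule psd_carrier)
  obtain r R S where R: "R \<in> carrier_mat d r" and S: "S \<in> carrier_mat r d"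
    and A_eq: "A = R * mat_adjoint R" and SR: "S * R = 1\<^sub>m r"
    by (rule psd_factor[OF A(1)])
  note R' = mat_adjoint_carrier[OF R] and S' = mat_adjoint_carrier[OF S]
  \<comment> \<open>A possibly oblique projection onto the range of \<open>A\<close>.\<close>
  define P where "P = R * S"
  have P: "P \<in> carrier_mat d d" unfolding P_def by (rule mult_carrier_mat[OF R S])
  note P' = mat_adjoint_carrier[OF P]
  have PA: "P * A = A"
    unfolding P_def A_eq assoc_mult_mat[OF R S mult_carrier_mat[OF R R']]
      assoc_mult_mat[OF S R R', symmetric] SR left_mult_one_mat[OF R'] ..
  \<comment> \<open>The \<open>M h g\<close> are positive semidefinite summands of \<open>A\<close>,
    so \<open>D = 1\<^sub>m d - P\<close>, which annihilates \<open>A\<close> from the left,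
    annihilates each of them.\<close>
  have PM: "P * M h g = M h g" if hg: "h \<in> V" "g \<in> W" for h g
  proof -
    define D where "D = 1\<^sub>m d - P"
    have D: "D \<in> carrier_mat d d" unfolding D_def by (rule minus_carrier_mat[OF P])
    have DB: "D * B = B - P * B" if "B \<in> carrier_mat d d" for B
      using minus_mult_distrib_mat[OF one_carrier_mat P that] that by (simp add: D_def)
    have "D * mat_sum d W (M h) = 0\<^sub>m d d"
      unfolding M_sum[OF hg(1)] DB[OF Ac] PA using Ac by simp
    then have "D * M h g = 0\<^sub>m d d"
      using psd_sum_range[where I = W and M = "M h", OF _ M D] hg G by (simp add: W_def)
    then have *: "M h g - P * M h g = 0\<^sub>m d d"
      unfolding DB[OF Mc[OF hg]] .
    show ?thesis
    proof (rule eq_matI)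
      fix i j assume "i < dim_row (M h g)" "j < dim_col (M h g)"
      then have ij: "i < d" "j < d" using Mc[OF hg] by auto
      have "(M h g - P * M h g) $$ (i, j) = 0"
        unfolding * using ij by simp
      then show "(P * M h g) $$ (i, j) = M h g $$ (i, j)"
        using ij P Mc[OF hg] by (simp del: index_mult_mat(1))
    qed (use P Mc[OF hg] in auto)
  qed
  have MP: "M h g * mat_adjoint P = M h g" if hg: "h \<in> V" "g \<in> W" for h g
    using mat_adjoint_mult[OF P Mc[OF hg]] PM[OF hg] psd_adjoint[OF M[OF hg]] by simp
  \<comment> \<open>Compression by \<open>S\<close> sends \<open>A = R * mat_adjoint R\<close> to
    the identity, which gives completeness of the measurements.\<close>
  define X where "X h g = S * M h g * mat_adjoint S" for h g
  \<comment> \<open>This transpose cancels the one in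
    \<open>expectation_value_kronecker\<close>.\<close>
  define Y where "Y h g = transpose_mat (X h g)" for h g
  have X: "psd r (X h g)" if "h \<in> V" "g \<in> W" for h g
    unfolding X_def by (rule psd_congruence[OF M[OF that] S])
  have Xc: "X h g \<in> carrier_mat r r" if "h \<in> V" "g \<in> W" for h g
    using X[OF that] by (rule psd_carrier)
  have X_sum: "mat_sum r W (X h) = 1\<^sub>m r" if h: "h \<in> V" for h
  proof -
    have "mat_sum r W (X h) = S * (R * mat_adjoint R) * mat_adjoint S"
      unfolding X_def A_eq[symmetric] M_sum[OF h, symmetric]
      by (rule mat_sum_congruence[OF Mc[OF h] S S'])
    also have "\<dots> = S * R * (mat_adjoint R * mat_adjoint S)"
      unfolding assoc_mult_mat[OF S R R', symmetric] assoc_mult_mat[OF mult_carrier_mat[OF S R] R' S'] ..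
    also have "mat_adjoint R * mat_adjoint S = mat_adjoint (S * R)"
      by (rule mat_adjoint_mult[OF S R, symmetric])
    finally show ?thesis
      unfolding SR psd_adjoint[OF psd_one] by simp
  qed
  have Xm: "measurement r W (X h)" if "h \<in> V" for h
    using X X_sum that by (simp add: measurement_mat_sum)
  have Ym: "measurement r W (Y h)" if "h \<in> V" for h
    using X X_sum that mat_sum_transpose[of W "X h", OF Xc[OF that]]
    by (simp add: measurement_mat_sum Y_def[abs_def] psd_transpose)
  \<comment> \<open>Conjugation by \<open>R\<close> undoes the compression up to \<open>P\<close> on
    the left and its adjoint on the right, and both fix \<open>M h g\<close>.\<close>
  have RXR: "R * X h g * mat_adjoint R = M h g" if hg: "h \<in> V" "g \<in> W" for h g
  proof -
    note m = Mc[OF hg]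
    have "R * X h g * mat_adjoint R = R * (S * (M h g * mat_adjoint S)) * mat_adjoint R"
      unfolding X_def assoc_mult_mat[OF S m S'] ..
    also have "\<dots> = P * (M h g * mat_adjoint S) * mat_adjoint R"
      unfolding P_def assoc_mult_mat[OF R S mult_carrier_mat[OF m S']] ..
    also have "\<dots> = P * M h g * mat_adjoint S * mat_adjoint R"
      unfolding assoc_mult_mat[OF P m S'] ..
    also have "\<dots> = M h g * (mat_adjoint S * mat_adjoint R)"
      unfolding PM[OF hg] assoc_mult_mat[OF m S' R'] ..
    also have "mat_adjoint S * mat_adjoint R = mat_adjoint P"
      unfolding P_def by (rule mat_adjoint_mult[OF R S, symmetric])
    finally show ?thesis unfolding MP[OF hg] .
  qed
  \<comment> \<open>The matrix of the state. By cyclicity \<open>K * K\<close> has the same trace as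
    \<open>A * A\<close>, which makes the state a unit vector.\<close>
  define K where "K = mat_adjoint R * R"
  have K: "K \<in> carrier_mat r r" unfolding K_def by (rule mult_carrier_mat[OF R' R])
  have K_adj: "mat_adjoint K = K"
    unfolding K_def mat_adjoint_mult[OF R' R] mat_adjoint_adjoint ..
  \<comment> \<open>Row-by-row reading of \<open>K\<close>, following the index convention of
    \<open>kronecker\<close>.\<close>
  define \<psi> where "\<psi> = vec (r * r) (\<lambda>p. K $$ (p div r, p mod r))"
  have \<psi>: "\<psi> \<in> carrier_vec (r * r)" by (simp add: \<psi>_def)
  have K_eq: "K = mat r r (\<lambda>(i, j). \<psi> $ (i * r + j))"
    using K by (intro eq_matI) (auto simp: \<psi>_def index_pair_less)
  have norm: "\<psi> \<bullet>c \<psi> = 1"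
  proof -
    have "\<psi> \<bullet>c \<psi> = mat_trace (mat_adjoint R * R * (mat_adjoint R * R))"
      unfolding cscalar_prod_self_trace[OF \<psi> K_eq] K_adj unfolding K_def ..
    also have "\<dots> = mat_trace (mat_adjoint R * (R * (mat_adjoint R * R)))"
      unfolding assoc_mult_mat[OF R' R mult_carrier_mat[OF R' R]] ..
    also have "\<dots> = mat_trace (R * (mat_adjoint R * R) * mat_adjoint R)"
      by (rule trace_mult_commute[OF R' mult_carrier_mat[OF R mult_carrier_mat[OF R' R]]])
    also have "R * (mat_adjoint R * R) * mat_adjoint R = A * A"
      unfolding A_eq assoc_mult_mat[OF R R' R, symmetric]
        assoc_mult_mat[OF mult_carrier_mat[OF R R'] R R'] ..
    finally show ?thesis unfolding A(2) .
  qed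
  \<comment> \<open>Substituting \<open>K = mat_adjoint R * R\<close> and moving the last
    \<open>R\<close> to the front makes both operators appear between \<open>R\<close> and
    \<open>mat_adjoint R\<close>, where \<open>RXR\<close> applies.\<close>
  have p: "expectation_value \<psi> (kronecker (X s a) (Y t b)) = mat_trace (M s a * M t b)"
    if st: "s \<in> V" "t \<in> V" "a \<in> W" "b \<in> W" for s t a b
  proof -
    note x = Xc[OF st(1,3)] and y = Xc[OF st(2,4)]
    note Rx = mult_carrier_mat[OF R x] and Ry = mult_carrier_mat[OF R y]
    have "expectation_value \<psi> (kronecker (X s a) (Y t b)) = mat_trace (X s a * (K * X t b * K))"
      unfolding Y_def expectation_value_kronecker[OF \<psi> x transpose_carrier_mat[THEN iffD2, OF y] K_eq] K_adj
      by simp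
    also have "K * X t b * K = mat_adjoint R * (R * X t b * mat_adjoint R * R)"
      unfolding K_def assoc_mult_mat[OF R' R y]
        assoc_mult_mat[OF R' Ry mult_carrier_mat[OF R' R]] assoc_mult_mat[OF Ry R' R] ..
    also have "X s a * (mat_adjoint R * (R * X t b * mat_adjoint R * R)) =
        X s a * mat_adjoint R * (M t b * R)"
      unfolding RXR[OF st(2,4)]
      by (rule assoc_mult_mat[OF x R' mult_carrier_mat[OF Mc[OF st(2,4)] R], symmetric])
    also have "\<dots> = X s a * mat_adjoint R * M t b * R"
      by (rule assoc_mult_mat[OF mult_carrier_mat[OF x R'] Mc[OF st(2,4)] R, symmetric])
    also have "mat_trace \<dots> = mat_trace (R * (X s a * mat_adjoint R * M t b))"
      by (rule trace_mult_commute[OF mult_carrier_mat[OF mult_carrier_mat[OF x R'] Mc[OF st(2,4)]] R])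
    also have "R * (X s a * mat_adjoint R * M t b) = M s a * M t b"
      unfolding assoc_mult_mat[OF R mult_carrier_mat[OF x R'] Mc[OF st(2,4)], symmetric]
        assoc_mult_mat[OF R x R', symmetric] RXR[OF st(1,3)] ..
    finally show ?thesis .
  qed
  have "(\<Sum>s \<in> questions1 (hom_game H G). \<Sum>t \<in> questions2 (hom_game H G).
      complex_of_real (distr (hom_game H G) s t) *
        (\<Sum>a \<in> answers1 (hom_game H G). \<Sum>b \<in> answers2 (hom_game H G).
          complex_of_real (verdict (hom_game H G) a b s t) *
            expectation_value \<psi> (kronecker (X s a) (Y t b)))) = 1"
  proof (subst hom_game_value_eq_1_iff[OF H G])
    fix s t assume st: "s \<in> pverts H" "t \<in> pverts H"
    then show "0 \<le> expectation_value \<psi> (kronecker (X s a) (Y t b))"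
      if "a \<in> pverts G" "b \<in> pverts G" for a b
      using trace_mult_psd(1)[OF M M] that by (simp add: p V_def W_def)
    have "(\<Sum>a\<in>W. \<Sum>b\<in>W. mat_trace (M s a * M t b)) = mat_trace (A * A)"
      using st by (subst sum_trace_mult[of _ _ d]) (auto simp: V_def Mc M_sum)
    then show "(\<Sum>a\<in>pverts G. \<Sum>b\<in>pverts G. expectation_value \<psi> (kronecker (X s a) (Y t b))) = 1"
      using st A(2) by (simp add: p V_def W_def)
  qed (use M_orth p in \<open>auto simp: V_def W_def\<close>)
  moreover have "questions1 (hom_game H G) = V" "questions2 (hom_game H G) = V"
    "answers1 (hom_game H G) = W" "answers2 (hom_game H G) = W"
    by (simp_all add: hom_game_def V_def W_def)
  ultimately show ?thesis
    unfolding perfect_quantum_strategy_def using \<psi> norm Xm Ym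
    by (intro exI[of _ r] exI[of _ \<psi>] exI[of _ X] exI[of _ Y]) simp
qed

section \<open>Feasible Gram matrices and the Frobenius norm\<close>

definition cs_plus_hom :: "'h pair_pre_digraph \<Rightarrow> 'g pair_pre_digraph \<Rightarrow> bool" where
  "cs_plus_hom H G \<longleftrightarrow> (\<exists>X \<in> cs_plus (with_zero (pverts H \<times> pverts G)).
     X None None = 1 \<and>
     (\<forall>h \<in> pverts H.
        (\<Sum>g \<in> pverts G. \<Sum>g' \<in> pverts G. X (Some (h, g)) (Some (h, g'))) = 1 \<and>
        (\<Sum>g \<in> pverts G. X None (Some (h, g))) = 1) \<and>
     (\<forall>h \<in> pverts H. \<forall>h' \<in> pverts H. \<forall>g \<in> pverts G. \<forall>g' \<in> pverts G.
        forbidden H G h h' g g' \<longrightarrow> X (Some (h, g)) (Some (h', g')) = 0))"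

lemma psd_real_symmetric:
  "psd d (A :: real mat) \<Longrightarrow> i < d \<Longrightarrow> j < d \<Longrightarrow> A $$ (j, i) = A $$ (i, j)"
  using psd_conjugate_index[of d A i j] by simp

lemma trace_mult_symmetric:
  fixes A B :: "real mat"
  assumes "A \<in> carrier_mat d d" "B \<in> carrier_mat d d" "\<And>i j. i < d \<Longrightarrow> j < d \<Longrightarrow> B $$ (j, i) = B $$ (i, j)"
  shows "mat_trace (A * B) = (\<Sum>i<d. \<Sum>j<d. A $$ (i, j) * B $$ (i, j))"
  unfolding trace_mult[OF assms(1,2)] by (intro sum.cong refl) (use assms(3) in auto)

text \<open>For symmetric matrices \<open>mat_trace (A * C)\<close> is the entrywise inner product,
  so this is the expansion of a squared distance. It yields both an equality of matrices and a
  Bessel inequality.\<close>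

lemma trace_diff_square:
  fixes A C :: "real mat"
  assumes A: "A \<in> carrier_mat d d" "\<And>i j. i < d \<Longrightarrow> j < d \<Longrightarrow> A $$ (j, i) = A $$ (i, j)"
    and C: "C \<in> carrier_mat d d" "\<And>i j. i < d \<Longrightarrow> j < d \<Longrightarrow> C $$ (j, i) = C $$ (i, j)"
  shows "mat_trace (A * A) + mat_trace (C * C) - 2 * mat_trace (A * C) =
    (\<Sum>i<d. \<Sum>j<d. (A $$ (i, j) - C $$ (i, j))\<^sup>2)"
proof -
  have "mat_trace (A * A) = (\<Sum>i<d. \<Sum>j<d. A $$ (i, j) * A $$ (i, j))"
    "mat_trace (C * C) = (\<Sum>i<d. \<Sum>j<d. C $$ (i, j) * C $$ (i, j))"
    "mat_trace (A * C) = (\<Sum>i<d. \<Sum>j<d. A $$ (i, j) * C $$ (i, j))"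
    by (rule trace_mult_symmetric; fact A C)+
  then show ?thesis
    by (simp add: power2_eq_square algebra_simps sum.distrib sum_subtractf sum_distrib_left)
qed

lemma mat_sum_symmetric:
  fixes B :: "'i \<Rightarrow> real mat"
  assumes "\<And>i. i \<in> I \<Longrightarrow> psd d (B i)" "i < d" "j < d"
  shows "mat_sum d I B $$ (j, i) = mat_sum d I B $$ (i, j)"
  unfolding mat_sum_index[OF assms(2,3)] mat_sum_index[OF assms(3,2)]
  by (intro sum.cong refl) (use assms psd_real_symmetric in blast)

lemma trace_mult_mat_sum:
  fixes A :: "'a :: comm_ring_1 mat"
  assumes "A \<in> carrier_mat d d" "\<And>i. i \<in> I \<Longrightarrow> B i \<in> carrier_mat d d"
  shows "mat_trace (A * mat_sum d I B) = (\<Sum>i\<in>I. mat_trace (A * B i))"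
  using sum_trace_mult[of "{()}" "\<lambda>_. A" d I B] mat_sum_single[of "{()}" "()" "\<lambda>_. A" d] assms
  by simp

text \<open>With \<open>C\<close> the sum of the \<open>B i\<close>, the three traces make the
  squared Frobenius norm of \<open>A - C\<close> equal to \<open>1 + 1 - 2 = 0\<close>.\<close>

lemma mat_sum_eq_if_traces:
  fixes A :: "real mat"
  assumes A: "psd d A" and B: "\<And>i. i \<in> I \<Longrightarrow> psd d (B i)"
    and tr: "mat_trace (A * A) = 1" "(\<Sum>i\<in>I. mat_trace (A * B i)) = 1"
      "(\<Sum>i\<in>I. \<Sum>j\<in>I. mat_trace (B i * B j)) = 1"
  shows "mat_sum d I B = A"
proof -
  define C where "C = mat_sum d I B"
  note Ac = psd_carrier[OF A]
  have Bc: "B i \<in> carrier_mat d d" if "i \<in> I" for i using B[OF that] by (rule psd_carrier)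
  have C: "C \<in> carrier_mat d d" by (simp add: C_def)
  have C_sym: "C $$ (j, i) = C $$ (i, j)" if "i < d" "j < d" for i j
    unfolding C_def by (rule mat_sum_symmetric[OF B that])
  have "mat_trace (A * C) = 1" "mat_trace (C * C) = 1"
    using trace_mult_mat_sum[of A d I B] sum_trace_mult[of I B d I B] tr Ac Bc
    by (simp_all add: C_def)
  then have "(\<Sum>i<d. \<Sum>j<d. (A $$ (i, j) - C $$ (i, j))\<^sup>2) = 0"
    using trace_diff_square[of A d C] psd_real_symmetric[OF A] C_sym Ac C tr(1) by simp
  then have "\<forall>i<d. \<forall>j<d. A $$ (i, j) = C $$ (i, j)"
    by (simp add: sum_nonneg_eq_0_iff sum_nonneg)
  then have "C = A"
    using Ac C by (intro eq_matI) auto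
  then show ?thesis by (simp only: C_def)
qed

section \<open>Real and complex Gram matrices\<close>

text \<open>Split \<open>v\<close> into its real part \<open>x\<close> and imaginary part
  \<open>y\<close>. Symmetry cancels the mixed terms, and what remains is the sum of the real forms
  at \<open>x\<close> and at \<open>y\<close>.\<close>

lemma psd_map_of_real:
  fixes A :: "real mat"
  assumes A: "psd d A"
  shows "psd d (map_mat complex_of_real A)"
proof -
  note Ac = psd_carrier[OF A]
  have "0 \<le> (\<Sum>i<d. \<Sum>j<d. complex_of_real (A $$ (i, j)) * v j * cnj (v i))" for v
  proof -
    define x where "x i = Re (v i)" for i
    define y where "y i = Im (v i)" for i
    have "(\<Sum>i<d. \<Sum>j<d. A $$ (i, j) * y j * x i) = (\<Sum>i<d. \<Sum>j<d. A $$ (i, j) * x j * y i)"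
      by (subst sum.swap, intro sum.cong refl) (auto simp: psd_real_symmetric[OF A])
    then have "Im (\<Sum>i<d. \<Sum>j<d. complex_of_real (A $$ (i, j)) * v j * cnj (v i)) = 0"
      by (simp add: x_def y_def algebra_simps sum_subtractf)
    moreover have "Re (\<Sum>i<d. \<Sum>j<d. complex_of_real (A $$ (i, j)) * v j * cnj (v i)) =
        (\<Sum>i<d. \<Sum>j<d. A $$ (i, j) * x j * x i) + (\<Sum>i<d. \<Sum>j<d. A $$ (i, j) * y j * y i)"
      by (simp add: x_def y_def algebra_simps sum.distrib)
    ultimately show ?thesis
      using psd_quadratic_form[OF A, of x] psd_quadratic_form[OF A, of y]
      by (simp add: less_eq_complex_def)
  qed
  then show ?thesis
    using Ac by (subst psd_index) (auto simp: psd_real_symmetric[OF A])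
qed

lemma trace_mult_map_of_real:
  fixes A B :: "real mat"
  assumes "A \<in> carrier_mat d d" "B \<in> carrier_mat d d"
  shows "mat_trace (map_mat complex_of_real A * map_mat complex_of_real B) = of_real (mat_trace (A * B))"
proof -
  have "map_mat complex_of_real A \<in> carrier_mat d d" "map_mat complex_of_real B \<in> carrier_mat d d"
    using assms by auto
  then show ?thesis
    using assms by (simp add: trace_mult[of _ d d] del: index_mult_mat)
qed

lemma mat_sum_map_of_real:
  assumes "\<And>a. a \<in> I \<Longrightarrow> X a \<in> carrier_mat d d"
  shows "mat_sum d I (\<lambda>a. map_mat complex_of_real (X a)) = map_mat complex_of_real (mat_sum d I X)"
proof -
  have "map_mat complex_of_real (X a) $$ (i, j) = of_real (X a $$ (i, j))" if "a \<in> I" "i < d" "j < d" for a i j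
    using assms[OF that(1)] that by simp
  then show ?thesis
    by (intro eq_matI) (auto simp: mat_sum_def)
qed

text \<open>The matrices stay real here because both the passage to \<open>psd_hom\<close> and the
  cardinality bound for independent sets start from them.\<close>

lemma cs_plus_homE:
  assumes "cs_plus_hom H G"
  obtains d and A :: "real mat" and B where
    "psd d A" "mat_trace (A * A) = 1"
    "\<forall>h \<in> pverts H. \<forall>g \<in> pverts G. psd d (B h g)"
    "\<forall>h \<in> pverts H. mat_sum d (pverts G) (B h) = A"
    "\<forall>h \<in> pverts H. \<forall>h' \<in> pverts H. \<forall>g \<in> pverts G. \<forall>g' \<in> pverts G.
      forbidden H G h h' g g' \<longrightarrow> mat_trace (B h g * B h' g') = 0"
proof -
  define V where "V = pverts H"
  define W where "W = pverts G"
  from assms obtain X d and Z :: "('a \<times> 'b) option \<Rightarrow> real mat" where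
    Z: "\<forall>i \<in> with_zero (V \<times> W). psd d (Z i)"
    and XZ: "\<forall>i \<in> with_zero (V \<times> W). \<forall>j \<in> with_zero (V \<times> W). X i j = mat_trace (Z i * Z j)"
    and X: "X None None = 1"
     "\<forall>h \<in> V. (\<Sum>g \<in> W. \<Sum>g' \<in> W. X (Some (h, g)) (Some (h, g'))) = 1 \<and>
        (\<Sum>g \<in> W. X None (Some (h, g))) = 1"
     "\<forall>h \<in> V. \<forall>h' \<in> V. \<forall>g \<in> W. \<forall>g' \<in> W.
        forbidden H G h h' g g' \<longrightarrow> X (Some (h, g)) (Some (h', g')) = 0"
    unfolding cs_plus_hom_def cs_plus_def V_def[symmetric] W_def[symmetric] by blast
  have A: "psd d (Z None)" using Z by simp
  have B: "psd d (Z (Some (h, g)))" if "h \<in> V" "g \<in> W" for h g using Z that by simp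
  have AA: "mat_trace (Z None * Z None) = 1" using X(1) XZ by simp
  have sum: "mat_sum d W (\<lambda>g. Z (Some (h, g))) = Z None" if h: "h \<in> V" for h
    by (rule mat_sum_eq_if_traces[OF A B[OF h] AA]) (use X(2) h XZ in simp_all)
  have orth: "mat_trace (Z (Some (h, g)) * Z (Some (h', g'))) = 0"
    if "h \<in> V" "h' \<in> V" "g \<in> W" "g' \<in> W" "forbidden H G h h' g g'" for h h' g g'
    using X(3) XZ that by simp
  show ?thesis
    by (rule that[OF A AA, of "\<lambda>h g. Z (Some (h, g))"]) (use B sum orth in \<open>simp_all add: V_def W_def\<close>)
qed

lemma psd_hom_if_cs_plus_hom:
  assumes "cs_plus_hom H G"
  shows "psd_hom H G"
proof -
  from assms obtain d A B where
    A: "psd d A" "mat_trace (A * A) = 1"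
    and B: "\<forall>h \<in> pverts H. \<forall>g \<in> pverts G. psd d (B h g)"
    and sum: "\<forall>h \<in> pverts H. mat_sum d (pverts G) (B h) = (A :: real mat)"
    and orth: "\<forall>h \<in> pverts H. \<forall>h' \<in> pverts H. \<forall>g \<in> pverts G. \<forall>g' \<in> pverts G.
      forbidden H G h h' g g' \<longrightarrow> mat_trace (B h g * B h' g') = 0"
    by (rule cs_plus_homE)
  note B = B[rule_format] and sum = sum[rule_format] and orth = orth[rule_format]
  note Ac = psd_carrier[OF A(1)] and Bc = psd_carrier[OF B]
  let ?c = "map_mat complex_of_real"
  show ?thesis
    unfolding psd_hom_def
  proof (intro exI conjI ballI impI)
    show "psd d (?c A)" by (rule psd_map_of_real[OF A(1)])
    show "mat_trace (?c A * ?c A) = 1"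
      by (simp add: trace_mult_map_of_real[OF Ac Ac] A(2))
    show "psd d (?c (B h g))" if "h \<in> pverts H" "g \<in> pverts G" for h g
      by (rule psd_map_of_real[OF B[OF that]])
    show "mat_sum d (pverts G) (\<lambda>g. ?c (B h g)) = ?c A" if "h \<in> pverts H" for h
      using mat_sum_map_of_real[of "pverts G" "B h" d] Bc sum that by simp
    show "mat_trace (?c (B h g) * ?c (B h' g')) = 0"
      if "h \<in> pverts H" "h' \<in> pverts H" "g \<in> pverts G" "g' \<in> pverts G" "forbidden H G h h' g g'" for h h' g g'
      using that by (simp add: trace_mult_map_of_real[OF Bc Bc] orth)
  qed
qed

text \<open>The matrix of \<open>A\<close> as a real linear map, with the real parts of a vector in
  the first \<open>d\<close> coordinates and the imaginary parts in the last
  \<open>d\<close>.\<close>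

definition real_form :: "nat \<Rightarrow> complex mat \<Rightarrow> real mat" where
  "real_form d A = mat (d + d) (d + d) (\<lambda>(i, j).
     if i < d then if j < d then Re (A $$ (i, j)) else - Im (A $$ (i, j - d))
     else if j < d then Im (A $$ (i - d, j)) else Re (A $$ (i - d, j - d)))"

lemma real_form_carrier: "real_form d A \<in> carrier_mat (d + d) (d + d)"
  by (simp add: real_form_def)

lemma real_form_index:
  assumes "i < d" "j < d"
  shows "real_form d A $$ (i, j) = Re (A $$ (i, j))" "real_form d A $$ (i, d + j) = - Im (A $$ (i, j))"
    "real_form d A $$ (d + i, j) = Im (A $$ (i, j))" "real_form d A $$ (d + i, d + j) = Re (A $$ (i, j))"
  using assms by (simp_all add: real_form_def)

lemma sum_lessThan_double:
  fixes f :: "nat \<Rightarrow> 'a :: comm_monoid_add"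
  shows "(\<Sum>p<d + d. f p) = (\<Sum>i<d. f i) + (\<Sum>i<d. f (d + i))"
  using sum_lessThan_mult[of f 2 d] by (simp add: numeral_2_eq_2)

text \<open>Each of the two diagonal blocks of the product contributes
  \<open>Re (mat_trace (A * B))\<close>.\<close>

lemma trace_real_form:
  assumes A: "A \<in> carrier_mat d d" and B: "B \<in> carrier_mat d d"
  shows "mat_trace (real_form d A * real_form d B) = 2 * Re (mat_trace (A * B))"
  unfolding trace_mult[OF A B] trace_mult[OF real_form_carrier real_form_carrier] sum_lessThan_double
  by (simp add: real_form_index sum.distrib sum_subtractf sum_negf)

lemma psd_real_form:
  assumes A: "psd d A"
  shows "psd (d + d) (real_form d A)"
proof -
  have herm: "Re (A $$ (j, i)) = Re (A $$ (i, j))" "Im (A $$ (j, i)) = - Im (A $$ (i, j))"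
    if "i < d" "j < d" for i j
    using psd_conjugate_index[OF A that] by (auto simp: complex_eq_iff)
  have sym: "real_form d A $$ (q, p) = real_form d A $$ (p, q)" if "p < d + d" "q < d + d" for p q
    using that herm[of p q] herm[of "p - d" q] herm[of p "q - d"] herm[of "p - d" "q - d"]
    by (auto simp: real_form_def)
  have "0 \<le> (\<Sum>p<d + d. \<Sum>q<d + d. real_form d A $$ (p, q) * v q * v p)" for v
  proof -
    \<comment> \<open>Pairing the coordinates into complex numbers identifies the real form at
      \<open>v\<close> with the real part of the Hermitian form of \<open>A\<close> at
      \<open>w\<close>.\<close>
    define w where "w i = Complex (v i) (v (d + i))" for i
    have "(\<Sum>p<d + d. \<Sum>q<d + d. real_form d A $$ (p, q) * v q * v p) =
        (\<Sum>i<d. \<Sum>j<d. real_form d A $$ (i, j) * v j * v i +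
          real_form d A $$ (i, d + j) * v (d + j) * v i +
          real_form d A $$ (d + i, j) * v j * v (d + i) +
          real_form d A $$ (d + i, d + j) * v (d + j) * v (d + i))"
      by (simp only: sum_lessThan_double sum.distrib add.assoc)
    also have "\<dots> = (\<Sum>i<d. \<Sum>j<d. Re (A $$ (i, j) * w j * cnj (w i)))"
      by (intro sum.cong refl) (simp add: real_form_index, simp add: w_def algebra_simps)
    finally have "(\<Sum>p<d + d. \<Sum>q<d + d. real_form d A $$ (p, q) * v q * v p) =
        Re (\<Sum>i<d. \<Sum>j<d. A $$ (i, j) * w j * cnj (w i))"
      by simp
    then show ?thesis
      using psd_quadratic_form[OF A, of w] by (simp add: less_eq_complex_def)
  qed
  then show ?thesis
    using sym by (subst psd_index[OF real_form_carrier]) auto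
qed

text \<open>\<open>real_form\<close> replaces complex matrices by real ones of twice the size.
  Taking \<open>Re\<close> loses nothing, as these traces are real by
  \<open>trace_mult_psd\<close>.\<close>

lemma complex_gram_in_cs_plus:
  assumes "1 \<le> d" and Z: "\<And>i. i \<in> I \<Longrightarrow> psd d (Z i)"
  shows "(\<lambda>i j. Re (mat_trace (Z i * Z j))) \<in> cs_plus I"
proof -
  \<comment> \<open>The factor \<open>1 / sqrt 2\<close> on each matrix cancels the 2 in
    \<open>trace_real_form\<close>.\<close>
  let ?X = "\<lambda>i. (1 / sqrt 2) \<cdot>\<^sub>m real_form d (Z i)"
  have "psd (d + d) (?X i)" if "i \<in> I" for i
    by (rule psd_smult[OF psd_real_form[OF Z[OF that]]]) auto
  moreover have "Re (mat_trace (Z i * Z j)) = mat_trace (?X i * ?X j)" if "i \<in> I" "j \<in> I" for i j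
    unfolding trace_smult_mult[OF real_form_carrier real_form_carrier]
      trace_real_form[OF psd_carrier[OF Z[OF that(1)]] psd_carrier[OF Z[OF that(2)]]]
    by simp
  ultimately show ?thesis
    unfolding cs_plus_def using assms(1) by (intro CollectI exI[of _ "d + d"] conjI exI[of _ ?X]) auto
qed

lemma cs_plus_hom_if_psd_hom:
  assumes "psd_hom H G"
  shows "cs_plus_hom H G"
proof -
  define V where "V = pverts H"
  define W where "W = pverts G"
  from assms obtain d and A :: "complex mat" and M where
    A: "psd d A" "mat_trace (A * A) = 1"
    and M: "\<And>h g. h \<in> V \<Longrightarrow> g \<in> W \<Longrightarrow> psd d (M h g)"
    and M_sum: "\<And>h. h \<in> V \<Longrightarrow> mat_sum d W (M h) = A"
    and M_orth: "\<And>h h' g g'. h \<in> V \<Longrightarrow> h' \<in> V \<Longrightarrow> g \<in> W \<Longrightarrow> g' \<in> W \<Longrightarrow>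
      forbidden H G h h' g g' \<Longrightarrow> mat_trace (M h g * M h' g') = 0"
    unfolding psd_hom_def V_def[symmetric] W_def[symmetric] by blast
  note Ac = psd_carrier[OF A(1)] and Mc = psd_carrier[OF M]
  define Z where "Z i = (case i of None \<Rightarrow> A | Some (h, g) \<Rightarrow> M h g)" for i
  let ?X = "\<lambda>i j. Re (mat_trace (Z i * Z j))"
  \<comment> \<open>\<open>cs_plus\<close> requires a positive size; a matrix without rows would
    have trace 0 instead of 1.\<close>
  have "1 \<le> d"
    using A(2) Ac by (cases d) (auto simp: mat_trace_def)
  then have "?X \<in> cs_plus (with_zero (V \<times> W))"
    by (rule complex_gram_in_cs_plus) (auto simp: Z_def A M)
  moreover have "(\<Sum>g \<in> W. \<Sum>g' \<in> W. ?X (Some (h, g)) (Some (h, g'))) = 1"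
    "(\<Sum>g \<in> W. ?X None (Some (h, g))) = 1" if h: "h \<in> V" for h
    using sum_trace_mult[of W "M h" d W "M h"] trace_mult_mat_sum[of A d W "M h"] M_sum[OF h] A(2) Ac Mc[OF h]
    by (simp_all add: Z_def Re_sum[symmetric] del: Re_sum)
  ultimately show ?thesis
    unfolding cs_plus_hom_def V_def[symmetric] W_def[symmetric]
    by (intro bexI[of _ ?X]) (auto simp: Z_def A M_orth)
qed

theorem perfect_quantum_strategy_iff_cs_plus_hom:
  assumes "finite (pverts H)" "pverts H \<noteq> {}" "parcs H \<subseteq> pverts H \<times> pverts H" "finite (pverts G)"
  shows "perfect_quantum_strategy (hom_game H G) \<longleftrightarrow> cs_plus_hom H G"
  using psd_hom_if_perfect[OF assms] perfect_if_psd_hom[OF assms] cs_plus_hom_if_psd_hom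
    psd_hom_if_cs_plus_hom by blast

section \<open>Specialisation to colourings and independent sets\<close>

lemma cs_plus_coloring_iff:
  "cs_plus_coloring G k \<longleftrightarrow> cs_plus_hom G (complete_graph k)"
proof -
  \<comment> \<open>Two colours are nonadjacent in the complete graph exactly if they are
    equal.\<close>
  have "forbidden G (complete_graph k) g g' i i' \<longleftrightarrow> (g = g' \<and> i \<noteq> i') \<or> ((g, g') \<in> parcs G \<and> i = i')"
    if "i \<in> {1..k}" "i' \<in> {1..k}" for g g' i i'
    using that by (auto simp: forbidden_def complete_graph_def)
  then show ?thesis
    unfolding cs_plus_coloring_def cs_plus_hom_def by (simp add: complete_graph_def)
qed

lemma cs_plus_independent_iff:
  "cs_plus_independent G k \<longleftrightarrow> cs_plus_hom (complete_graph k) (complement_graph G)"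
proof -
  \<comment> \<open>Nonadjacency in the complement means equality or adjacency in
    \<open>G\<close>.\<close>
  have "forbidden (complete_graph k) (complement_graph G) i i' g g' \<longleftrightarrow>
      (i = i' \<and> g \<noteq> g') \<or> (i \<noteq> i' \<and> (g = g' \<or> (g, g') \<in> parcs G))"
    if "i \<in> {1..k}" "i' \<in> {1..k}" "g \<in> pverts G" "g' \<in> pverts G" for g g' i i'
    using that by (auto simp: forbidden_def complete_graph_def complement_graph_def)
  then show ?thesis
    unfolding cs_plus_independent_def cs_plus_hom_def
    by (simp add: complete_graph_def complement_graph_def)
qed

text \<open>Matrices of size 1 suffice. Classical solutions are vectors of zeros and ones, which
  become feasible Gram matrices in this way.\<close>

lemma rank_one_in_cs_plus:
  assumes "\<And>i. i \<in> I \<Longrightarrow> 0 \<le> v i"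
  shows "(\<lambda>i j. v i * v j) \<in> cs_plus I"
proof -
  let ?X = "\<lambda>i. mat 1 1 (\<lambda>_. v i) :: real mat"
  have c: "?X i \<in> carrier_mat 1 1" for i by simp
  have "psd 1 (?X i)" if "i \<in> I" for i
    unfolding psd_index[OF c] using assms[OF that] by (simp add: mult.assoc)
  moreover have "v i * v j = mat_trace (?X i * ?X j)" for i j
    unfolding trace_mult[OF c c] by simp
  ultimately show ?thesis
    unfolding cs_plus_def by (intro CollectI exI[of _ 1] conjI exI[of _ ?X]) auto
qed

text \<open>Witness for the minimum in \<open>chi_q\<close>: every vertex receives its own
  colour.\<close>

lemma cs_plus_coloring_card:
  assumes "finite (pverts G)" "\<And>g. (g, g) \<notin> parcs G"
  shows "cs_plus_coloring G (card (pverts G))"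
proof -
  obtain f where f: "bij_betw f (pverts G) {1..card (pverts G)}"
    using ex_bij_betw_nat_finite_1[OF assms(1)] bij_betw_inv by blast
  \<comment> \<open>Indicator of the deterministic assignment \<open>f\<close>, with value 1 at the
    extra index \<open>None\<close>.\<close>
  define v where "v p = (case p of None \<Rightarrow> 1 | Some (g, i) \<Rightarrow> if i = f g then 1 else (0 :: real))" for p
  let ?X = "\<lambda>p q. v p * v q"
  have "?X \<in> cs_plus (with_zero (pverts G \<times> {1..card (pverts G)}))"
    by (rule rank_one_in_cs_plus) (auto simp: v_def split: option.split)
  moreover have "f g \<in> {1..card (pverts G)}" if "g \<in> pverts G" for g
    using f that by (auto simp: bij_betw_def)
  moreover have "f g = f g' \<longleftrightarrow> g = g'" if "g \<in> pverts G" "g' \<in> pverts G" for g g'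
    using f that by (auto simp: bij_betw_def inj_on_def)
  ultimately show ?thesis
    unfolding cs_plus_coloring_def
    by (intro bexI[of _ ?X]) (use assms(2) in \<open>auto simp: v_def sum_distrib_left[symmetric]\<close>)
qed

text \<open>Witness for the maximum in \<open>alpha_q\<close>: one fixed vertex answers the only
  question.\<close>

lemma cs_plus_independent_1:
  assumes "finite (pverts G)" "pverts G \<noteq> {}"
  shows "cs_plus_independent G 1"
proof -
  obtain g where g: "g \<in> pverts G" using assms(2) by blast
  define v where "v p = (case p of None \<Rightarrow> 1 | Some (i :: nat, g') \<Rightarrow> if g' = g then 1 else (0 :: real))" for p
  let ?X = "\<lambda>p q. v p * v q"
  have "?X \<in> cs_plus (with_zero ({1..1} \<times> pverts G))"
    by (rule rank_one_in_cs_plus) (auto simp: v_def split: option.split)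
  then show ?thesis
    unfolding cs_plus_independent_def
    by (intro bexI[of _ ?X]) (use assms(1) g in \<open>auto simp: v_def sum_distrib_left[symmetric]\<close>)
qed

text \<open>
  For a fixed vertex, the matrices \<open>B i g\<close> with \<open>i \<le> k\<close> are mutually orthogonal summands of \<open>A\<close>, so
  Bessel's inequality bounds the sum of their squared norms by \<open>1\<close>; over all vertices these sums
  add up to \<open>k\<close>.
\<close>

lemma cs_plus_independent_le_card:
  assumes fin: "finite (pverts G)" and "cs_plus_independent G k"
  shows "k \<le> card (pverts G)"
proof -
  define V where "V = pverts G"
  have VH: "pverts (complete_graph k) = {1..k}" "pverts (complement_graph G) = V"
    by (simp_all add: V_def complete_graph_def complement_graph_def)
  obtain d A B where
    A: "psd d A" and AA: "mat_trace (A * A) = 1"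
    and B: "\<forall>i \<in> {1..k}. \<forall>g \<in> V. psd d (B i g)"
    and sum: "\<forall>i \<in> {1..k}. mat_sum d V (B i) = (A :: real mat)"
    and forb: "\<forall>i \<in> {1..k}. \<forall>i' \<in> {1..k}. \<forall>g \<in> V. \<forall>g' \<in> V.
      forbidden (complete_graph k) (complement_graph G) i i' g g' \<longrightarrow> mat_trace (B i g * B i' g') = 0"
    by (rule cs_plus_homE[OF assms(2)[unfolded cs_plus_independent_iff], unfolded VH])
  note B = B[rule_format] and sum = sum[rule_format] and forb = forb[rule_format]
  \<comment> \<open>Either one index carries two vertices, or two indices carry the same vertex,
    which is not adjacent to itself in the complement.\<close>
  have orth: "mat_trace (B i g * B i' g') = 0"
    if "i \<in> {1..k}" "i' \<in> {1..k}" "g \<in> V" "g' \<in> V" "(i = i') \<noteq> (g = g')" for i i' g g'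
    by (rule forb) (use that in \<open>auto simp: forbidden_def complete_graph_def complement_graph_def\<close>)
  note Ac = psd_carrier[OF A] and Bc = psd_carrier[OF B]
  define s where "s g = (\<Sum>i\<in>{1..k}. mat_trace (B i g * B i g))" for g
  have AB: "(\<Sum>g\<in>V. mat_trace (A * B i g)) = 1" if "i \<in> {1..k}" for i
    using trace_mult_mat_sum[OF Ac, of V "B i"] Bc sum AA that by simp
  \<comment> \<open>\<open>A\<close> is the sum of the mutually orthogonal \<open>B i g'\<close>, of
    which only \<open>g' = g\<close> contributes to the trace.\<close>
  have AB_eq: "mat_trace (A * B i g) = mat_trace (B i g * B i g)" if "i \<in> {1..k}" "g \<in> V" for i g
  proof -
    have "mat_trace (A * B i g) = mat_trace (B i g * A)"
      by (rule trace_mult_commute[OF Ac Bc[OF that]])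
    also have "\<dots> = (\<Sum>g'\<in>V. mat_trace (B i g * B i g'))"
      unfolding sum[OF that(1), symmetric] by (rule trace_mult_mat_sum[OF Bc[OF that] Bc[OF that(1)]])
    also have "\<dots> = mat_trace (B i g * B i g)"
      using fin that by (subst sum.remove[of _ g]) (auto simp: V_def intro!: sum.neutral orth)
    finally show ?thesis .
  qed
  \<comment> \<open>Both \<open>mat_trace (T * T)\<close> and \<open>mat_trace (A * T)\<close> equal
    \<open>s g\<close>, so the squared Frobenius norm of \<open>A - T\<close> is
    \<open>1 - s g\<close>.\<close>
  have "s g \<le> 1" if g: "g \<in> V" for g
  proof -
    define T where "T = mat_sum d {1..k} (\<lambda>i. B i g)"
    have T: "T \<in> carrier_mat d d" by (simp add: T_def)
    have "mat_trace (T * T) = (\<Sum>i\<in>{1..k}. \<Sum>i'\<in>{1..k}. mat_trace (B i g * B i' g))"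
      unfolding T_def by (rule sum_trace_mult[symmetric]) (use Bc g in auto)
    also have "\<dots> = s g"
      unfolding s_def
    proof (rule sum.cong[OF refl])
      show "(\<Sum>i'\<in>{1..k}. mat_trace (B i g * B i' g)) = mat_trace (B i g * B i g)" if "i \<in> {1..k}" for i
        using that g by (subst sum.remove[of _ i]) (auto intro!: sum.neutral orth)
    qed
    finally have "mat_trace (T * T) = s g" .
    moreover have "mat_trace (A * T) = s g"
      unfolding T_def s_def using Ac Bc g AB_eq by (subst trace_mult_mat_sum) (auto intro!: sum.cong)
    moreover have "0 \<le> (\<Sum>i<d. \<Sum>j<d. (A $$ (i, j) - T $$ (i, j))\<^sup>2)"
      by (intro sum_nonneg) simp
    then have "0 \<le> mat_trace (A * A) + mat_trace (T * T) - 2 * mat_trace (A * T)"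
      using trace_diff_square[of A d T] Ac T psd_real_symmetric[OF A]
        mat_sum_symmetric[of "{1..k}" d "\<lambda>i. B i g"] B g
      by (simp add: T_def)
    ultimately show ?thesis using AA by simp
  qed
  then have "(\<Sum>g\<in>V. s g) \<le> (\<Sum>g\<in>V. 1)"
    by (rule sum_mono)
  \<comment> \<open>After exchanging the sums, \<open>AB\<close> evaluates the inner sum to 1 for
    each of the \<open>k\<close> indices.\<close>
  moreover have "(\<Sum>g\<in>V. s g) = (\<Sum>i\<in>{1..k}. \<Sum>g\<in>V. mat_trace (A * B i g))"
    unfolding s_def by (subst sum.swap) (simp add: AB_eq)
  moreover have "\<dots> = real k"
    using AB by simp
  ultimately show ?thesis by (simp add: V_def)
qed

theorem corollary5p14:
  fixes G :: "'v pair_pre_digraph"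
  assumes "pair_graph G" and "pverts G \<noteq> {}"
  shows
    "(1 \<le> chi_q G \<and> cs_plus_coloring G (chi_q G) \<and>
       (\<forall>k \<ge> 1. cs_plus_coloring G k \<longrightarrow> chi_q G \<le> k)) \<and>
     (1 \<le> alpha_q G \<and> cs_plus_independent G (alpha_q G) \<and>
       (\<forall>k \<ge> 1. cs_plus_independent G k \<longrightarrow> k \<le> alpha_q G))"
proof -
  interpret pair_graph G by (fact assms(1))
  have parcs: "parcs G \<subseteq> pverts G \<times> pverts G" using in_arcsD1 in_arcsD2 by auto
  have chi: "perfect_quantum_strategy (hom_game G (complete_graph k)) \<longleftrightarrow> cs_plus_coloring G k" for k
    unfolding cs_plus_coloring_iff
    by (rule perfect_quantum_strategy_iff_cs_plus_hom) (use assms(2) parcs in \<open>auto simp: complete_graph_def\<close>)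
  \<comment> \<open>The conjunct \<open>1 \<le> k\<close> stays on both sides because it makes the
    vertex set of \<open>complete_graph k\<close> nonempty.\<close>
  have alpha: "1 \<le> k \<and> perfect_quantum_strategy (hom_game (complete_graph k) (complement_graph G)) \<longleftrightarrow>
      1 \<le> k \<and> cs_plus_independent G k" for k
    unfolding cs_plus_independent_iff
    by (rule conj_cong[OF refl], rule perfect_quantum_strategy_iff_cs_plus_hom)
      (auto simp: complete_graph_def complement_graph_def)
  have no_loops: "(g, g) \<notin> parcs G" for g
    using pair_no_loops[of "(g, g)"] by auto
  have "1 \<le> card (pverts G) \<and> cs_plus_coloring G (card (pverts G))"
    using assms(2) cs_plus_coloring_card[of G, OF _ no_loops] by (simp add: Suc_le_eq card_gt_0_iff)
  then have "1 \<le> chi_q G \<and> cs_plus_coloring G (chi_q G)"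
    unfolding chi_q_def chi by (rule LeastI)
  moreover have "chi_q G \<le> k" if "1 \<le> k" "cs_plus_coloring G k" for k
    unfolding chi_q_def chi using that by (intro Least_le conjI)
  \<comment> \<open>\<open>GREATEST\<close> on \<open>nat\<close> yields a maximum only under an
    upper bound, which the number of vertices provides.\<close>
  moreover have bound: "k \<le> card (pverts G)" if "1 \<le> k \<and> cs_plus_independent G k" for k
    using cs_plus_independent_le_card[OF pair_finite_verts] that by blast
  have "1 \<le> alpha_q G \<and> cs_plus_independent G (alpha_q G)"
    unfolding alpha_q_def alpha
    by (rule GreatestI_nat[where k = 1, OF _ bound]) (use cs_plus_independent_1[OF pair_finite_verts assms(2)] in simp_all)
  moreover have "k \<le> alpha_q G" if "1 \<le> k" "cs_plus_independent G k" for k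
    unfolding alpha_q_def alpha by (rule Greatest_le_nat[where b = "card (pverts G)"]) (use that bound in simp_all)
  ultimately show ?thesis by blast
qed

end
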